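(* Let $f$ be a spectral density on $\Lambda$ with $f>0$ a.e. on $S:=\{\lambda: e^{i\lambda}\in\overline{E_f}\}$. Then: (a) If $\overline{E_f}=\Gamma_{2\alpha}(\theta_0)$ with $0<\alpha<\pi$, then $\lim_{n\to\infty}\sqrt[n]{\sigma_n(f)}=\sin(\alpha/2)$. (b) If $\overline{E_f}=\Gamma(k,\alpha)$ (with $k\ge2$, $\alpha>0$, $k\alpha<2\pi$), then $\lim_{n\to\infty}\sqrt[n]{\sigma_n(f)}=(\sin(k\alpha/4))^{1/k}$. (c) If $\overline{E_f}=\Gamma_{\alpha,\delta}(\theta_0)$ with $\alpha>0$, $\delta\ge0$, $\alpha+\delta\le\pi$, then $\lim_{n\to\infty}\sqrt[n]{\sigma_n(f)}=(\sin(\alpha/2)\sin(\alpha/2+\delta))^{1/2}$. (d) If $\overline{E_f}=\Delta_{\alpha,\delta}(\theta_0)$ with $\alpha>0$, $\delta\ge0$, $\alpha+\delta\le\pi/2$, then $\lim_{n\to\infty}\sqrt[n]{\sigma_n(f)}=(\sin\alpha\,\sin(\alpha+2\delta))^{1/4}$.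
   Context: $\Lambda=[-\pi,\pi]$. A spectral density is $f\ge0$, $f\in L^1(\Lambda)$, positive on a set of positive measure; $E_f=\{e^{i\lambda}:f(\lambda)>0\}$, $\overline{E_f}$ its closure. $\sigma_n^2(f)=\min_{c_1,\dots,c_n\in\mathbb C}\int_\Lambda|1-\sum_{k=1}^n c_ke^{-ik\lambda}|^2f(\lambda)\,d\lambda$, $\sigma_n(f)=\sqrt{\sigma_n^2(f)}$. Sets on the unit circle, for $\theta_0\in[-\pi,\pi)$: $\Gamma_{2\alpha}(\theta_0)=\{e^{i\theta}:|\theta-\theta_0|\le\alpha\}$ (closed arc of length $2\alpha$ centered at $e^{i\theta_0}$); $\Gamma_{\alpha,\delta}(\theta_0)=\{e^{i\theta}:\delta\le|\theta-\theta_0|\le\delta+\alpha\}$ (two closed arcs of length $\alpha$ at circular distance $2\delta$); $\Gamma(k,\alpha)$ = union of $k$ closed arcs of equal length $\alpha$ placed equidistantly on the unit circle (i.e. up to rotation, the preimage under $z\mapsto z^k$ of an arc of length $k\alpha$); $\Delta_{\alpha,\delta}(\theta_0)=e^{i\theta_0}\cdot\big(\Gamma_{\alpha,\delta}(0)\cup\Gamma'_{\alpha,\delta}\big)$ where $\Gamma'_{\alpha,\delta}=\{e^{i\theta}:\theta\in[-\pi+\delta,-\pi+\delta+\alpha]\cup[\pi-\delta-\alpha,\pi-\delta]\}$ (four arcs of length $\alpha$ symmetric with respect to both axes, rotated by $\theta_0$). *)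

theory Defs
  imports "HOL-Analysis.Analysis"
begin

definition spectral_density :: "(real \<Rightarrow> real) \<Rightarrow> bool" where
  "spectral_density f \<longleftrightarrow>
     (\<forall>l\<in>{-pi..pi}. 0 \<le> f l) \<and> f integrable_on {-pi..pi} \<and>
     emeasure lebesgue {l\<in>{-pi..pi}. 0 < f l} > 0"

definition Ef :: "(real \<Rightarrow> real) \<Rightarrow> complex set" where
  "Ef f = {cis l | l. l \<in> {-pi..pi} \<and> 0 < f l}"

definition sigma2 :: "(real \<Rightarrow> real) \<Rightarrow> nat \<Rightarrow> real" where
  "sigma2 f n = (INF c :: nat \<Rightarrow> complex.
      integral {-pi..pi}
        (\<lambda>l. (cmod (1 - (\<Sum>k=1..n. c k * cis (- (real k * l))))) ^ 2 * f l))"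

definition sigma :: "(real \<Rightarrow> real) \<Rightarrow> nat \<Rightarrow> real" where
  "sigma f n = sqrt (sigma2 f n)"

definition arc2 :: "real \<Rightarrow> real \<Rightarrow> complex set" where
  "arc2 a t0 = {cis t | t. \<bar>t - t0\<bar> \<le> a}"

definition arcs_k :: "nat \<Rightarrow> real \<Rightarrow> real \<Rightarrow> complex set" where
  "arcs_k k a t0 = (\<Union>j<k. arc2 (a/2) (t0 + 2 * pi * real j / real k))"

definition arcs_ad :: "real \<Rightarrow> real \<Rightarrow> real \<Rightarrow> complex set" where
  "arcs_ad a d t0 = {cis t | t. d \<le> \<bar>t - t0\<bar> \<and> \<bar>t - t0\<bar> \<le> d + a}"

definition arcs_ad' :: "real \<Rightarrow> real \<Rightarrow> complex set" where
  "arcs_ad' a d = {cis t | t. t \<in> {-pi + d .. -pi + d + a} \<union> {pi - d - a .. pi - d}}"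

text \<open>Delta_{a,d}(t0): four arcs symmetric w.r.t. both axes, rotated by t0.\<close>
definition Delta_ad :: "real \<Rightarrow> real \<Rightarrow> real \<Rightarrow> complex set" where
  "Delta_ad a d t0 = (\<lambda>z. cis t0 * z) ` (arcs_ad a d 0 \<union> arcs_ad' a d)"

end

theory Submission
  imports Defs "HOL-Computational_Algebra.Fundamental_Theorem_Algebra"
begin

text \<open>
  All four sets have the form \<open>{e^{il} : M - r \<le> cos (k l - t) \<le> M + r}\<close>, and the limit is
  \<open>r^{1/(2k)}\<close>. In the variable \<open>v = e^{-il}\<close> the quantity \<open>\<sigma>_n^2\<close> is the minimum of
  \<open>\<integral>|p|^2 f\<close> over polynomials \<open>p\<close> of degree at most \<open>n\<close> with \<open>p(0) = 1\<close>.

  Upper bound: Chebyshev polynomials of \<open>(cos (k l - t) - M) / r\<close>, multiplied by a power of \<open>v\<close>,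
  are admissible and small on the set.

  Lower bound: let \<open>W\<close> be the density of the equilibrium measure, namely the pullback of the arcsine
  distribution on \<open>[M - r, M + r]\<close>. Its logarithmic potential at a zero in the disc is at least
  \<open>ln r / (2k)\<close>, so the \<open>W\<close>-mean of \<open>ln |p|\<close> is at least \<open>n ln r / (2k)\<close>. Replacing \<open>W\<close> by
  \<open>min (m f) W\<close> costs only \<open>n ln 2\<close> times the lost mass, which tends to \<open>0\<close> as \<open>m\<close> grows because
  \<open>f > 0\<close> almost everywhere on the set; Jensen's inequality then bounds \<open>\<integral>|p|^2 f\<close> from below.
\<close>

section \<open>Periodic integrals and the mean of the logarithm\<close>

lemma periodic_int_shift:
  fixes G :: "real \<Rightarrow> 'a"
  assumes "\<And>x. G (x + T) = G x"
  shows "G (x + of_int m * T) = G x"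
proof -
  have nat: "G (x + real n * T) = G x" for n x
  proof (induction n)
    case (Suc n)
    have "G (x + real (Suc n) * T) = G ((x + real n * T) + T)"
      by (simp add: algebra_simps)
    then show ?case using assms Suc by simp
  qed simp
  show ?thesis
  proof (cases m rule: int_cases2)
    case (nonneg n)
    then show ?thesis using nat[of x n] by simp
  next
    case (nonpos n)
    then show ?thesis using nat[of "x - real n * T" n] by simp
  qed
qed

text \<open>Translating by whole periods moves the start \<open>b\<close> to a point
  \<open>c\<close> of the original window; the piece over \<open>{a..c}\<close> is then carried one
  period to the right, so that it completes \<open>{c..c+T}\<close>.\<close>

lemma has_integral_periodic:
  fixes G :: "real \<Rightarrow> real"
  assumes per: "\<And>x. G (x + T) = G x" and T: "T > 0"
    and G: "(G has_integral I) {a..a+T}"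
  shows "(G has_integral I) {b..b+T}"
proof -
  define m where "m = \<lfloor>(b - a) / T\<rfloor>"
  define c where "c = b - of_int m * T"
  have "of_int m \<le> (b - a) / T" "(b - a) / T < of_int m + 1"
    unfolding m_def by linarith+
  then have c: "a \<le> c" "c \<le> a + T"
    using T by (simp_all add: c_def field_simps)
  have int: "G integrable_on {a..c}" "G integrable_on {c..a+T}"
    using G c by (auto intro: integrable_subinterval_real has_integral_integrable)
  define I1 I2 where "I1 = integral {a..c} G" and "I2 = integral {c..a+T} G"
  have I1: "(G has_integral I1) {a..c}" and I2: "(G has_integral I2) {c..a+T}"
    using int by (auto simp: I1_def I2_def)
  have "I = I1 + I2"
    using has_integral_combine[OF c I1 I2] G has_integral_unique by blast
  have "((\<lambda>x. G (x + (- T))) has_integral I1) {a+T..c+T}"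
    using has_integral_shift_real_ivl[OF I1, of "-T"] by simp
  moreover have "G (x + (- T)) = G x" for x
    using per[of "x - T"] by simp
  ultimately have I1': "(G has_integral I1) {a+T..c+T}" by simp
  have "(G has_integral I) {c..c+T}"
    using has_integral_combine[OF _ _ I2 I1'] c \<open>I = I1 + I2\<close> by (simp add: add.commute)
  then have "((\<lambda>x. G (x + of_int (- m) * T)) has_integral I) {b..b+T}"
    using has_integral_shift_real_ivl[of G I c "c+T" "of_int (- m) * T"]
    by (simp add: c_def algebra_simps)
  moreover have "G (x + of_int (- m) * T) = G x" for x
    by (rule periodic_int_shift) (rule per)
  ultimately show ?thesis by (simp only:)
qed

text \<open>The map \<open>x\<close> to \<open>k x - t\<close> sends the circle onto
  \<open>k\<close> full periods; their total \<open>k * I\<close> is cancelled by the factor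
  \<open>1 / k\<close> of the substitution.\<close>

lemma has_integral_periodic_affine:
  fixes G :: "real \<Rightarrow> real"
  assumes per: "\<And>x. G (x + 2 * pi) = G x" and k: "k > 0"
    and G: "(G has_integral I) {-pi..pi}"
  shows "((\<lambda>x. G (real k * x - t)) has_integral I) {-pi..pi}"
proof -
  define a where "a = - real k * pi - t"
  have one: "(G has_integral I) {b..b + 2*pi}" for b
    using has_integral_periodic[of G "2*pi" I "-pi"] per G by simp
  have "(G has_integral (real j * I)) {a..a + real j * (2*pi)}" for j
  proof (induction j)
    case 0
    then show ?case using has_integral_null_real[of a a G] by auto
  next
    case (Suc j)
    have "(G has_integral (real j * I + I)) {a..a + real j * (2*pi) + 2*pi}"
      by (rule has_integral_combine[OF _ _ Suc.IH one]) auto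
    then show ?case by (simp add: algebra_simps)
  qed
  from this[of k] have "(G has_integral (real k * I)) (cbox a (a + real k * (2*pi)))"
    by simp
  from has_integral_affinity'[OF this, of "real k" "-t"] k
  show ?thesis by (simp add: a_def field_simps)
qed

text \<open>As polynomials in \<open>z\<close> both sides have degree at most \<open>k\<close>, and
  they agree at \<open>k + 1\<close> points: the \<open>k\<close>-th roots of unity, where both
  vanish, and 0, where both equal 1.\<close>

lemma prod_one_minus_roots_unity:
  fixes z :: complex
  assumes "k > 0"
  shows "(\<Prod>j<k. 1 - z * cis (2 * pi * real j / real k)) = 1 - z ^ k"
proof -
  define P where "P = (\<Prod>j<k. [:1, - cis (2 * pi * real j / real k):])"
  define Q :: "complex poly" where "Q = 1 - monom 1 k"
  define A where "A = insert 0 {z::complex. z ^ k = 1}"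
  have fin: "finite {z::complex. z ^ k = 1}"
    using assms by (simp add: finite_roots_unity)
  have "card A = k + 1"
    unfolding A_def using fin assms card_roots_unity_eq[of k]
    by (subst card_insert_disjoint) (auto simp: power_0_left)
  moreover have "degree P \<le> (\<Sum>j<k. degree [:1, - cis (2 * pi * real j / real k):])"
    unfolding P_def by (rule order_trans[OF degree_prod_sum_le]) auto
  then have "degree P \<le> k" by simp
  moreover have "degree Q \<le> k"
    unfolding Q_def by (intro degree_diff_le) (auto simp: degree_monom_le)
  moreover have "poly P w = poly Q w" if "w \<in> A" for w
  proof (cases "w = 0")
    case True
    then show ?thesis using assms by (simp add: P_def Q_def poly_prod poly_monom)
  next
    case False
    with that have w: "w ^ k = 1" by (simp add: A_def)
    then have "inverse w ^ k = 1" by (simp add: power_inverse)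
    \<comment> \<open>The inverse of \<open>w\<close> is again a root of unity, and its factor is
      the one that vanishes at \<open>w\<close>.\<close>
    then obtain j where j: "j < k" "inverse w = cis (2 * pi * real j / real k)"
      using Complex.bij_betw_roots_unity[OF assms] unfolding bij_betw_def by blast
    have "poly P w = 0"
      unfolding P_def poly_prod using j False
      by (intro prod_zero) (auto simp: j(2)[symmetric] intro!: bexI[of _ j])
    then show ?thesis using w by (simp add: Q_def poly_monom)
  qed
  ultimately have "P = Q"
    by (intro poly_eqI_degree[of A]) auto
  then have "poly P z = poly Q z" by simp
  then show ?thesis by (simp add: P_def Q_def poly_prod poly_monom)
qed

lemma one_minus_disc_nonzero:
  assumes "cmod z < 1"
  shows "1 - z * cis t \<noteq> 0"
proof
  assume "1 - z * cis t = 0"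
  then have "cmod (z * cis t) = 1" by simp
  then show False using assms by (simp add: norm_mult)
qed

lemma continuous_log_one_minus:
  assumes "cmod z < 1"
  shows "continuous_on S (\<lambda>l. ln (cmod (1 - z * cis (c * l))))"
  by (intro continuous_intros) (use one_minus_disc_nonzero[OF assms] in auto)

lemma absolutely_integrable_continuous_mult:
  fixes g f :: "real \<Rightarrow> real"
  assumes "continuous_on {a..b} g" "f absolutely_integrable_on {a..b}"
  shows "(\<lambda>x. g x * f x) absolutely_integrable_on {a..b}"
proof (rule absolutely_integrable_bounded_measurable_product_real[OF _ _ _ assms(2)])
  show "g \<in> borel_measurable (lebesgue_on {a..b})"
    using assms(1) by (simp add: continuous_imp_measurable_on_sets_lebesgue)
  show "bounded (g ` {a..b})"
    using assms(1) compact_Icc compact_continuous_image compact_imp_bounded by blast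
qed auto

text \<open>Averaging over the rotations by \<open>k\<close>-th roots of unity, which leave \<open>W (k l - t)\<close> invariant,
  replaces \<open>z\<close> by \<open>z ^ k\<close>.\<close>

lemma has_integral_log_average:
  fixes W :: "real \<Rightarrow> real"
  assumes perW: "\<And>x. W (x + 2 * pi) = W x" and k: "k > 0" and z: "cmod z < 1"
    and I: "((\<lambda>l. ln (cmod (1 - z ^ k * cis (- t) * cis (- l))) * W l) has_integral I) {-pi..pi}"
    and Wk: "(\<lambda>l. W (real k * l - t)) absolutely_integrable_on {-pi..pi}"
  shows "((\<lambda>l. ln (cmod (1 - z * cis (- l))) * W (real k * l - t)) has_integral I / real k) {-pi..pi}"
proof -
  define h where "h = (\<lambda>l. ln (cmod (1 - z * cis (- l))))"
  define F where "F = (\<lambda>l. h l * W (real k * l - t))"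
  have cont: "continuous_on {-pi..pi} h"
    using continuous_log_one_minus[OF z, of _ "-1"] by (simp add: h_def)
  have "F absolutely_integrable_on {-pi..pi}"
    unfolding F_def by (rule absolutely_integrable_continuous_mult[OF cont Wk])
  then obtain J where J: "(F has_integral J) {-pi..pi}"
    using set_lebesgue_integral_eq_integral(1) by blast
  have perk: "W (y + real k * (2 * pi)) = W y" "W (y + real j * (2 * pi)) = W y" for y j
    using periodic_int_shift[of W "2*pi" y "int k", OF perW]
      periodic_int_shift[of W "2*pi" y "int j", OF perW] by simp_all
  have cisp: "cis (y - 2 * pi) = cis y" for y
    by (simp add: complex_eq_iff sin_diff cos_diff)
  have perF: "F (x + 2 * pi) = F x" for x
    using perk(1)[of "real k * x - t"] cisp[of "-x"]
    by (simp add: F_def h_def algebra_simps)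
  have shift: "((\<lambda>l. F (l - 2 * pi * real j / real k)) has_integral J) {-pi..pi}" for j
  proof -
    define c where "c = - 2 * pi * real j / real k"
    have "(F has_integral J) {-pi + c..-pi + c + 2*pi}"
      using has_integral_periodic[of F "2*pi" J "-pi" "-pi + c"] perF J by simp
    from has_integral_shift_real_ivl[OF this, of c]
    show ?thesis by (simp add: c_def algebra_simps)
  qed
  \<comment> \<open>The \<open>k\<close> rotated integrands all have integral \<open>J\<close>,
    while pointwise their sum is the integrand of \<open>I\<close> in the variable
    \<open>k l - t\<close>. Comparing both values gives \<open>k * J = I\<close>.\<close>
  have "((\<lambda>l. \<Sum>j<k. F (l - 2 * pi * real j / real k)) has_integral (\<Sum>j<k. J)) {-pi..pi}"
    by (intro has_integral_sum) (use shift in auto)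
  moreover have "(\<Sum>j<k. F (l - 2 * pi * real j / real k)) =
      ln (cmod (1 - z ^ k * cis (- t) * cis (- (real k * l - t)))) * W (real k * l - t)" for l
  proof -
    have "F (l - 2 * pi * real j / real k) =
        ln (cmod (1 - (z * cis (- l)) * cis (2 * pi * real j / real k))) * W (real k * l - t)" for j
    proof -
      have "W (real k * (l - 2 * pi * real j / real k) - t) = W (real k * l - t)"
      proof -
        have "real k * l - t = real k * (l - 2 * pi * real j / real k) - t + real j * (2 * pi)"
          using k by (simp add: field_simps)
        then show ?thesis by (simp only: perk(2))
      qed
      moreover have "cis (- (l - 2 * pi * real j / real k)) = cis (- l) * cis (2 * pi * real j / real k)"
        by (simp add: cis_mult)
      ultimately show ?thesis by (simp add: F_def h_def mult.assoc)
    qed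
    then have "(\<Sum>j<k. F (l - 2 * pi * real j / real k)) =
        (\<Sum>j<k. ln (cmod (1 - (z * cis (- l)) * cis (2 * pi * real j / real k)))) * W (real k * l - t)"
      by (simp add: sum_distrib_right)
    also have "(\<Sum>j<k. ln (cmod (1 - (z * cis (- l)) * cis (2 * pi * real j / real k)))) =
        ln (\<Prod>j<k. cmod (1 - (z * cis (- l)) * cis (2 * pi * real j / real k)))"
    proof (rule ln_prod[symmetric])
      fix j
      show "cmod (1 - (z * cis (- l)) * cis (2 * pi * real j / real k)) \<noteq> 0"
        using one_minus_disc_nonzero[OF z, of "- l + 2 * pi * real j / real k"]
        by (simp add: mult.assoc cis_mult)
    qed auto
    also have "\<dots> = ln (cmod (1 - (z * cis (- l)) ^ k))"
      by (simp only: prod_norm prod_one_minus_roots_unity[OF k])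
    also have "(z * cis (- l)) ^ k = z ^ k * cis (- t) * cis (- (real k * l - t))"
      by (simp add: power_mult_distrib Complex.DeMoivre mult.assoc cis_mult)
    finally show ?thesis .
  qed
  moreover have "((\<lambda>l. ln (cmod (1 - z ^ k * cis (- t) * cis (- (real k * l - t)))) * W (real k * l - t))
      has_integral I) {-pi..pi}"
    by (rule has_integral_periodic_affine[OF _ k I]) (simp add: perW cisp)
  ultimately have "(\<Sum>j<k. J) = I"
    by (metis (no_types, lifting) has_integral_cong has_integral_unique)
  then have "real k * J = I" by simp
  then have "J = I / real k" using k by (simp add: field_simps)
  then show ?thesis using J by (simp add: F_def h_def)
qed

text \<open>The modulus lies between \<open>1 - a\<close> and \<open>1 + a\<close>, and
  \<open>1 + a <= 1 / (1 - a)\<close>. The bound is uniform over the disc of radius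
  \<open>a\<close>, hence over all powers of a fixed \<open>z\<close>.\<close>

lemma abs_log_one_minus_le:
  assumes "cmod z \<le> a" "a < 1"
  shows "\<bar>ln (cmod (1 - z * cis t))\<bar> \<le> ln (1 / (1 - a))"
proof -
  have a: "0 \<le> a" using assms norm_ge_zero order_trans by blast
  have "cmod (1 - z * cis t) \<ge> 1 - a"
    using norm_triangle_ineq2[of 1 "z * cis t"] assms by (simp add: norm_mult)
  moreover have "cmod (1 - z * cis t) \<le> 1 + a"
    using norm_triangle_ineq4[of 1 "z * cis t"] assms by (simp add: norm_mult)
  moreover have "1 + a \<le> 1 / (1 - a)"
    using assms a by (simp add: field_simps)
  ultimately have "ln (1 - a) \<le> ln (cmod (1 - z * cis t))" "ln (cmod (1 - z * cis t)) \<le> ln (1 / (1 - a))"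
    using assms by (subst ln_le_cancel_iff; linarith)+
  then show ?thesis using assms by (simp add: ln_div)
qed

text \<open>Averaging with constant weight gives \<open>g z = g (z ^ k) / k\<close> for the integral
  \<open>g\<close>. Since \<open>g (z ^ k)\<close> is bounded uniformly in \<open>k\<close>, letting
  \<open>k\<close> grow forces \<open>g z = 0\<close>.\<close>

lemma log_one_minus_mean_zero:
  assumes z: "cmod z < 1"
  shows "((\<lambda>l. ln (cmod (1 - z * cis (- l)))) has_integral 0) {-pi..pi}"
proof -
  define g where "g = (\<lambda>z. integral {-pi..pi} (\<lambda>l. ln (cmod (1 - z * cis (- l)))))"
  have g: "((\<lambda>l. ln (cmod (1 - z * cis (- l)))) has_integral g z) {-pi..pi}" if "cmod z < 1" for z
    using continuous_log_one_minus[OF that, of "{-pi..pi}" "-1"]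
    by (simp add: g_def integrable_continuous_real integrable_integral)
  have zk: "cmod (z ^ k) \<le> cmod z" if "k > 0" for k
    using z that power_decreasing[of 1 k "cmod z"] by (simp add: norm_power)
  have "g z = g (z ^ k) / real k" if k: "k > 0" for k
  proof -
    have "((\<lambda>l. ln (cmod (1 - z * cis (- l))) * 1) has_integral g (z ^ k) / real k) {-pi..pi}"
      by (rule has_integral_log_average[where W = "\<lambda>_. 1" and t = 0])
         (use k z g[of "z ^ k"] zk[OF k] in \<open>auto intro!: absolutely_integrable_continuous_real\<close>)
    then show ?thesis by (intro has_integral_unique[OF g[OF z]]) simp
  qed
  moreover have "\<bar>g (z ^ k)\<bar> \<le> 2 * pi * ln (1 / (1 - cmod z))" if k: "k > 0" for k
  proof -
    have "norm (g (z ^ k)) \<le> ln (1 / (1 - cmod z)) * measure lborel (cbox (-pi) pi)"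
    proof (rule has_integral_bound)
      show "((\<lambda>l. ln (cmod (1 - z ^ k * cis (- l)))) has_integral g (z ^ k)) (cbox (-pi) pi)"
        using g[of "z ^ k"] zk[OF k] z by simp
      show "norm (ln (cmod (1 - z ^ k * cis (- l)))) \<le> ln (1 / (1 - cmod z))" for l
        using abs_log_one_minus_le[OF zk[OF k] z] by simp
    qed (use z in auto)
    then show ?thesis by (simp add: mult.commute)
  qed
  ultimately have "\<bar>g z\<bar> \<le> (2 * pi * ln (1 / (1 - cmod z))) / real k" if "k > 0" for k
    using that by (metis abs_div_pos divide_right_mono of_nat_0_le_iff of_nat_0_less_iff)
  then have "\<bar>g z\<bar> \<le> 0"
    by (intro LIMSEQ_le_const[OF lim_const_over_n[of "2 * pi * ln (1 / (1 - cmod z))"]])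
       (auto intro: exI[of _ 1])
  then show ?thesis using g[OF z] by simp
qed

section \<open>Logarithmic potential of the arcsine weight\<close>

text \<open>The pullback under cos of the density \<open>1 / sqrt (r^2 - (x - M)^2)\<close>,
  extended by 0. Each half circle receives mass pi, so the total over a period is
  \<open>2 * pi\<close> instead of 1.\<close>

definition arcsine_weight :: "real \<Rightarrow> real \<Rightarrow> real \<Rightarrow> real" where
  "arcsine_weight M r t =
     (if \<bar>cos t - M\<bar> < r then \<bar>sin t\<bar> / sqrt (r\<^sup>2 - (cos t - M)\<^sup>2) else 0)"

lemma arcsine_weight_nonneg: "0 \<le> arcsine_weight M r t"
proof (cases "\<bar>cos t - M\<bar> < r")
  case True
  then have "(cos t - M)\<^sup>2 \<le> r\<^sup>2"
    by (intro power2_le_iff_abs_le[THEN iffD2]) auto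
  then show ?thesis by (simp add: arcsine_weight_def)
qed (simp add: arcsine_weight_def)

lemma arcsine_weight_minus: "arcsine_weight M r (- t) = arcsine_weight M r t"
  by (simp add: arcsine_weight_def)

lemma arcsine_weight_periodic: "arcsine_weight M r (t + 2 * pi) = arcsine_weight M r t"
  by (simp add: arcsine_weight_def)

lemma arcsine_weight_pos_imp: "0 < arcsine_weight M r t \<Longrightarrow> \<bar>cos t - M\<bar> < r"
  by (simp add: arcsine_weight_def split: if_splits)

text \<open>The substitution \<open>cos \<tau> = M + r cos \<phi>\<close> turns the weight into Lebesgue measure.\<close>

lemma arcsine_weight_half:
  fixes h :: "real \<Rightarrow> real"
  assumes r: "0 < r" and M: "\<bar>M\<bar> + r \<le> 1" and h: "continuous_on UNIV h"
  shows "(\<lambda>t. h t * arcsine_weight M r t) absolutely_integrable_on {0..pi}"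
    and "((\<lambda>p. h (arccos (M + r * cos p))) has_integral
            integral {0..pi} (\<lambda>t. h t * arcsine_weight M r t)) {0..pi}"
proof -
  define g where "g = (\<lambda>p. arccos (M + r * cos p))"
  \<comment> \<open>At the endpoints \<open>M + r * cos p\<close> may equal 1 or -1, where arccos is
    not differentiable; they are left out as a null set.\<close>
  define S where "S = {0<..<pi}"
  define F where "F = (\<lambda>t. h t * arcsine_weight M r t)"
  define g' where "g' = (\<lambda>p. r * sin p / sqrt (1 - (M + r * cos p)\<^sup>2))"
  have cos1: "\<bar>cos p\<bar> < 1" if "p \<in> S" for p
    using that cos_monotone_0_pi[of 0 p] cos_monotone_0_pi[of p pi] by (auto simp: S_def)
  have x1: "\<bar>M + r * cos p\<bar> < 1" if "p \<in> S" for p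
  proof -
    have "\<bar>r * cos p\<bar> < r" using cos1[OF that] r by (simp add: abs_mult)
    then show ?thesis using M by linarith
  qed
  have x1': "\<bar>M + r * cos p\<bar> \<le> 1" for p
  proof -
    have "\<bar>r * cos p\<bar> \<le> r" using r by (simp add: abs_mult)
    then show ?thesis using M by linarith
  qed
  have x1'': "- 1 \<le> M + r * cos p" "M + r * cos p \<le> 1" for p
    using x1'[of p] by linarith+
  have sq: "(M + r * cos p)\<^sup>2 < 1" if "p \<in> S" for p
    using x1[OF that] by (simp add: abs_square_less_1)
  have cosg: "cos (g p) = M + r * cos p" for p
    using x1'[of p] by (simp add: g_def cos_arccos_abs)
  have der: "(g has_field_derivative g' p) (at p within S)" if "p \<in> S" for p
  proof -
    have "(g has_real_derivative inverse (- sqrt (1 - (M + r * cos p)\<^sup>2)) * (r * (- sin p))) (at p within S)"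
      unfolding g_def
      by (rule DERIV_chain'[where g = arccos])
         (use x1[OF that] in \<open>auto intro!: derivative_eq_intros DERIV_arccos\<close>)
    then show ?thesis by (simp add: g'_def field_simps)
  qed
  have inj: "inj_on g S"
  proof (rule inj_onI)
    fix p q assume "p \<in> S" "q \<in> S" "g p = g q"
    then have "cos p = cos q" using cosg[of p] cosg[of q] r by simp
    moreover have "0 \<le> p" "p \<le> pi" "0 \<le> q" "q \<le> pi"
      using \<open>p \<in> S\<close> \<open>q \<in> S\<close> by (auto simp: S_def)
    ultimately show "p = q" by (metis arccos_cos)
  qed
  \<comment> \<open>The Jacobian cancels the weight: at \<open>g p\<close> the root in the weight is
    \<open>r * sin p\<close>, and \<open>sin (g p)\<close> is the denominator of
    \<open>g' p\<close>.\<close>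
  have key: "\<bar>g' p\<bar> * F (g p) = h (g p)" if "p \<in> S" for p
  proof -
    have sp: "0 < sin p" using that by (simp add: S_def sin_gt_zero)
    have "sin (g p) = sqrt (1 - (M + r * cos p)\<^sup>2)"
      unfolding g_def using x1''[of p] by (intro sin_arccos)
    moreover have "r\<^sup>2 - (r * cos p)\<^sup>2 = (r * sin p)\<^sup>2"
      by (simp add: power_mult_distrib sin_squared_eq algebra_simps)
    moreover have "\<bar>r * cos p\<bar> < r" using cos1[OF that] r by (simp add: abs_mult)
    ultimately show ?thesis
      using sq[OF that] sp r by (simp add: F_def arcsine_weight_def cosg g'_def)
  qed
  have contg: "continuous_on {0..pi} (\<lambda>p. h (g p))"
    unfolding g_def using x1''
    by (intro continuous_on_compose2[OF h] continuous_intros) auto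
  then have hg: "(\<lambda>p. h (g p)) absolutely_integrable_on {0..pi}"
    by (rule absolutely_integrable_continuous_real)
  then have hgS: "(\<lambda>p. h (g p)) absolutely_integrable_on S"
    unfolding S_def using absolutely_integrable_on_open_interval[where a = 0 and b = pi and f = "\<lambda>p. h (g p)"] by simp
  have lhs: "(\<lambda>p. \<bar>g' p\<bar> *\<^sub>R F (g p)) absolutely_integrable_on S"
  proof -
    have "(\<lambda>p. \<bar>g' p\<bar> *\<^sub>R F (g p)) absolutely_integrable_on S \<longleftrightarrow>
        (\<lambda>p. h (g p)) absolutely_integrable_on S"
      by (rule set_integrable_cong) (auto simp: key)
    then show ?thesis using hgS by simp
  qed
  have *: "F absolutely_integrable_on g ` S \<and>
      integral (g ` S) F = integral S (\<lambda>p. \<bar>g' p\<bar> *\<^sub>R F (g p))"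
    by (subst has_absolute_integral_change_of_variables_real[symmetric, OF _ der inj])
       (use lhs in \<open>auto simp: S_def\<close>)
  \<comment> \<open>Where the weight is nonzero, \<open>cos t\<close> lies strictly inside the
    interval, so \<open>t\<close> is in the image of \<open>S\<close>. Hence the integrals over that
    image and over \<open>{0..pi}\<close> agree.\<close>
  have zero: "F t = 0" if "t \<in> {0..pi} - g ` S" for t
  proof (rule ccontr)
    assume "F t \<noteq> 0"
    then have t: "\<bar>cos t - M\<bar> < r" "sin t \<noteq> 0"
      by (auto simp: F_def arcsine_weight_def split: if_splits)
    define p where "p = arccos ((cos t - M) / r)"
    have bd: "\<bar>(cos t - M) / r\<bar> < 1" using t r by (simp add: field_simps)
    then have "- 1 < (cos t - M) / r" "(cos t - M) / r < 1" by linarith+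
    then have p: "p \<in> S" unfolding p_def S_def using arccos_lt_bounded by simp
    have "cos p = (cos t - M) / r" unfolding p_def using bd by (simp add: cos_arccos_abs)
    then have "g p = arccos (cos t)" using r by (simp add: g_def)
    then have "g p = t" using that by (simp add: arccos_cos)
    then show False using that p by blast
  qed
  have sub: "g ` S \<subseteq> {0..pi}"
  proof safe
    fix p assume "p \<in> S"
    show "g p \<in> {0..pi}" unfolding g_def using arccos_bounded[of "M + r * cos p"] x1''[of p]
      by auto
  qed
  have "{t \<in> {0..pi} - g ` S. F t \<noteq> 0} = {}" "{t \<in> g ` S - {0..pi}. F t \<noteq> 0} = {}"
    using zero sub by blast+
  then have neg: "negligible {t \<in> {0..pi} - g ` S. F t \<noteq> 0}" "negligible {t \<in> g ` S - {0..pi}. F t \<noteq> 0}"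
    by (simp_all only: negligible_empty)
  show "F absolutely_integrable_on {0..pi}"
    using absolutely_integrable_spike_set[where S = "g ` S" and T = "{0..pi}" and f = F] * neg by blast
  have "integral {0..pi} F = integral (g ` S) F"
    using integral_spike_set[where S = "{0..pi}" and T = "g ` S" and f = F] neg by simp
  also have "\<dots> = integral S (\<lambda>p. h (g p))"
    using * key by (simp cong: integral_cong)
  also have "\<dots> = integral {0..pi} (\<lambda>p. h (g p))"
    unfolding S_def using integral_open_interval_real[where a = 0 and b = pi and f = "\<lambda>p. h (g p)"] by simp
  finally show "((\<lambda>p. h (g p)) has_integral integral {0..pi} F) {0..pi}"
    using hg set_lebesgue_integral_eq_integral(1) integrable_integral by metis
qed

text \<open>With \<open>v\<close> a square root of \<open>u\<close> and \<open>w = 1 / v\<close>,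
  the two numbers are \<open>(v - w)^2 / 2\<close> and \<open>(v + w)^2 / 2\<close>, and the
  parallelogram law applies.\<close>

lemma joukowski_norm:
  fixes u :: complex
  assumes "u \<noteq> 0"
  shows "cmod ((u + 1 / u) / 2 - 1) + cmod ((u + 1 / u) / 2 + 1) = cmod u + 1 / cmod u"
proof -
  define v w where "v = csqrt u" and "w = 1 / v"
  have v: "v\<^sup>2 = u" "v \<noteq> 0" using assms by (auto simp: v_def)
  then have vw: "v * w = 1" "w\<^sup>2 = 1 / u" by (auto simp: w_def power_divide)
  have "(u + 1 / u) / 2 - 1 = (v - w)\<^sup>2 / 2" "(u + 1 / u) / 2 + 1 = (v + w)\<^sup>2 / 2"
    using v(1) vw by (auto simp: power2_eq_square algebra_simps add_divide_distrib diff_divide_distrib)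
  then have "cmod ((u + 1 / u) / 2 - 1) + cmod ((u + 1 / u) / 2 + 1)
      = ((cmod (v - w))\<^sup>2 + (cmod (v + w))\<^sup>2) / 2"
    by (simp only: norm_divide norm_power add_divide_distrib) simp
  also have "\<dots> = (cmod v)\<^sup>2 + (cmod w)\<^sup>2"
    by (simp only: cmod_power2) (simp add: power2_eq_square algebra_simps)
  also have "\<dots> = cmod u + 1 / cmod u"
    using v(1) vw(2) by (metis norm_divide norm_one norm_power)
  finally show ?thesis .
qed

text \<open>\<open>|y - 1| + |y + 1| = |u| + 1/|u|\<close> measures the confocal ellipse on which the Joukowski image
  \<open>y\<close> of \<open>u\<close> lies. Shrinking by \<open>x = M + r y\<close> towards a point of \<open>[-1, 1]\<close> cannot increase it,
  whence \<open>|u| \<le> |z|\<close> when \<open>x\<close> is the Joukowski image of \<open>z\<close>.\<close>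

lemma joukowski_factorization:
  fixes z :: complex
  assumes r: "0 < r" and M: "\<bar>M\<bar> + r \<le> 1" and z: "cmod z < 1"
  obtains u C where "cmod u < 1" "r \<le> cmod C"
    "\<And>p. 1 - 2 * z * of_real (M + r * cos p) + z\<^sup>2 = C * (1 - u * cis p) * (1 - u * cis (- p))"
proof (cases "z = 0")
  case True
  show thesis by (rule that[of 0 1]) (use True r M in auto)
next
  case False
  define x where "x = (z + 1 / z) / 2"
  define y where "y = (x - of_real M) / of_real r"
  define s where "s = csqrt (y\<^sup>2 - 1)"
  \<comment> \<open>The solutions of \<open>u + 1 / u = 2 * y\<close> are \<open>y + s\<close> and
    \<open>y - s\<close>. They are reciprocal, so one of them lies in the closed disc.\<close>
  have prod1: "(y + s) * (y - s) = 1"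
    by (simp add: s_def power2_eq_square[symmetric] square_diff_square_factored[symmetric] algebra_simps)
  obtain u where u: "u = y + s \<or> u = y - s" "cmod u \<le> 1"
  proof (cases "cmod (y + s) \<le> 1")
    case False
    have "cmod (y + s) * cmod (y - s) = 1" using prod1 by (metis norm_mult norm_one)
    then have "cmod (y - s) \<le> 1" using False
      mult_strict_mono[of 1 "cmod (y + s)" 1 "cmod (y - s)"] by fastforce
    then show ?thesis using that by blast
  qed (use that in blast)
  have uy: "u + 1 / u = 2 * y" and u0: "u \<noteq> 0"
  proof -
    have "(u = y + s \<and> 1 / u = y - s) \<or> (u = y - s \<and> 1 / u = y + s)"
      using u(1) prod1 by (metis div_by_0 mult.commute nonzero_eq_divide_eq mult_zero_left zero_neq_one)
    then show "u + 1 / u = 2 * y" by auto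
    show "u \<noteq> 0" using u(1) prod1 by auto
  qed
  have x: "x = of_real M + of_real r * y" using r by (simp add: y_def)
  have bound: "cmod z + 1 / cmod z \<le> cmod u + 1 / cmod u"
  proof -
    have F: "cmod (y - 1) + cmod (y + 1) = cmod u + 1 / cmod u"
      using joukowski_norm[OF u0] uy by simp
    have "x - 1 = of_real (M - 1 + r) + of_real r * (y - 1)"
      by (simp add: x algebra_simps)
    then have "cmod (x - 1) \<le> \<bar>M - 1 + r\<bar> + r * cmod (y - 1)"
      using r norm_triangle_ineq[of "of_real (M - 1 + r)" "of_real r * (y - 1)"]
      by (simp add: norm_mult del: of_real_diff of_real_add)
    moreover have "x + 1 = of_real (M + 1 - r) + of_real r * (y + 1)"
      by (simp add: x algebra_simps)
    then have "cmod (x + 1) \<le> \<bar>M + 1 - r\<bar> + r * cmod (y + 1)"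
      using r norm_triangle_ineq[of "of_real (M + 1 - r)" "of_real r * (y + 1)"]
      by (simp add: norm_mult del: of_real_diff of_real_add)
    moreover have "\<bar>M - 1 + r\<bar> = 1 - r - M" "\<bar>M + 1 - r\<bar> = M + 1 - r"
      using M by linarith+
    ultimately have "cmod (x - 1) + cmod (x + 1) \<le> 2 * (1 - r) + r * (cmod (y - 1) + cmod (y + 1))"
      by (simp add: algebra_simps)
    also have "\<dots> \<le> (1 - r) * (cmod (y - 1) + cmod (y + 1)) + r * (cmod (y - 1) + cmod (y + 1))"
    proof -
      have "2 \<le> cmod (y - 1) + cmod (y + 1)"
        using norm_triangle_ineq4[of "y + 1" "y - 1"] by simp
      then have "(1 - r) * 2 \<le> (1 - r) * (cmod (y - 1) + cmod (y + 1))"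
        using M by (intro mult_left_mono) auto
      then show ?thesis by simp
    qed
    also have "\<dots> = cmod (y - 1) + cmod (y + 1)" by (simp add: algebra_simps)
    finally show ?thesis using F joukowski_norm[OF False] by (simp add: x_def)
  qed
  \<comment> \<open>This inverts \<open>bound\<close>, because x + 1/x is strictly decreasing on (0,
    1]. The contradiction is reached after multiplying by \<open>cmod z * cmod u\<close>.\<close>
  have uz: "cmod u \<le> cmod z"
  proof (rule ccontr)
    assume "\<not> ?thesis"
    then have lt: "cmod z < cmod u" by simp
    have pos: "0 < cmod z" "0 < cmod u" using False u0 by auto
    have "cmod z * cmod u < 1"
      using z u(2) pos by (metis mult_less_le_imp_less mult.right_neutral less_eq_real_def)
    then have "(cmod u - cmod z) * (1 - cmod z * cmod u) > 0"
      using lt by (intro mult_pos_pos) auto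
    moreover have "cmod z * cmod u * (cmod z + 1 / cmod z) \<le> cmod z * cmod u * (cmod u + 1 / cmod u)"
      by (rule mult_left_mono[OF bound]) (use pos in auto)
    ultimately show False using pos by (simp add: algebra_simps)
  qed
  \<comment> \<open>The left side of the factorization is \<open>2 * z * r * (y - cos p)\<close> and
    the two factors in \<open>u\<close> multiply to \<open>2 * u * (y - cos p)\<close>;
    \<open>C\<close> is the quotient, and \<open>cmod u <= cmod z\<close> makes its modulus at least
    \<open>r\<close>.\<close>
  define C where "C = z * of_real r / u"
  show thesis
  proof (rule that[of u C])
    show "cmod u < 1" using uz z by simp
    have "r * cmod u \<le> r * cmod z" using uz r by simp
    then show "r \<le> cmod C" using r u0 by (simp add: C_def norm_mult norm_divide field_simps)
    fix p
    have cc: "cis p * cis (- p) = 1" "cis p + cis (- p) = 2 * of_real (cos p)"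
      by (simp_all add: cis_mult complex_eq_iff)
    have "(1 - u * cis p) * (1 - u * cis (- p)) = 1 - u * (cis p + cis (- p)) + u\<^sup>2 * (cis p * cis (- p))"
      by (simp add: algebra_simps power2_eq_square)
    also have "\<dots> = u * (u + 1 / u) - 2 * u * of_real (cos p)"
      unfolding cc using u0 by (simp add: algebra_simps power2_eq_square)
    also have "\<dots> = 2 * u * (y - of_real (cos p))" by (simp add: uy algebra_simps)
    finally have "C * (1 - u * cis p) * (1 - u * cis (- p)) = C * (2 * u * (y - of_real (cos p)))"
      by (simp add: mult.assoc)
    also have "\<dots> = 2 * z * (of_real r * y - of_real (r * cos p))"
      using u0 by (simp add: C_def algebra_simps)
    also have "of_real r * y = x - of_real M" by (simp add: x)
    also have "2 * z * (x - of_real M - of_real (r * cos p)) = 1 - 2 * z * of_real (M + r * cos p) + z\<^sup>2"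
      using False by (simp add: x_def algebra_simps power2_eq_square)
    finally show "1 - 2 * z * of_real (M + r * cos p) + z\<^sup>2 = C * (1 - u * cis p) * (1 - u * cis (- p))"
      by simp
  qed
qed

section \<open>Potential of the weight on the whole circle\<close>

lemma has_integral_fold_even:
  fixes f :: "real \<Rightarrow> real"
  assumes "(f has_integral I) {-a..a}" "0 \<le> a"
  shows "((\<lambda>x. f x + f (- x)) has_integral I) {0..a}"
proof -
  have int: "f integrable_on {0..a}" "f integrable_on {-a..0}"
    using assms by (auto intro: integrable_subinterval_real has_integral_integrable)
  then have i: "(f has_integral integral {0..a} f) {0..a}" "(f has_integral integral {-a..0} f) {-a..0}"
    by auto
  have "I = integral {-a..0} f + integral {0..a} f"
    using has_integral_combine[OF _ _ i(2) i(1)] assms has_integral_unique by auto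
  moreover have "((\<lambda>x. f (- x)) has_integral integral {-a..0} f) {0..a}"
    using has_integral_reflect_real[of f "integral {-a..0} f" 0 "-a"] i(2) by simp
  ultimately show ?thesis
    using has_integral_add[OF i(1), of "\<lambda>x. f (- x)" "integral {-a..0} f"] by (simp add: add.commute)
qed

text \<open>The weight is even, so the left half contributes the integral of \<open>h (- t)\<close>
  over the right half, and the substitution for \<open>{0..pi}\<close> applies to both
  parts.\<close>

lemma arcsine_weight_full:
  fixes h :: "real \<Rightarrow> real"
  assumes r: "0 < r" and M: "\<bar>M\<bar> + r \<le> 1" and h: "continuous_on UNIV h"
    and I: "((\<lambda>p. h (arccos (M + r * cos p)) + h (- arccos (M + r * cos p))) has_integral I) {0..pi}"
  shows "((\<lambda>t. h t * arcsine_weight M r t) has_integral I) {-pi..pi}"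
proof -
  define W where "W = arcsine_weight M r"
  have h': "continuous_on UNIV (\<lambda>t. h (- t))"
    by (intro continuous_on_compose2[OF h] continuous_intros) auto
  note half = arcsine_weight_half[OF r M h] arcsine_weight_half[OF r M h']
  define I1 I2 where "I1 = integral {0..pi} (\<lambda>t. h t * W t)" and "I2 = integral {0..pi} (\<lambda>t. h (- t) * W t)"
  have "I = I1 + I2"
    using has_integral_add[OF half(2) half(4)] I has_integral_unique
    unfolding I1_def I2_def W_def by blast
  have I1: "((\<lambda>t. h t * W t) has_integral I1) {0..pi}"
    using half(1) set_lebesgue_integral_eq_integral(1) integrable_integral unfolding I1_def W_def by blast
  have "((\<lambda>t. h (- t) * W t) has_integral I2) {0..pi}"
    using half(3) set_lebesgue_integral_eq_integral(1) integrable_integral unfolding I2_def W_def by blast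
  then have "((\<lambda>t. h (- t) * W (- t)) has_integral I2) {0..pi}"
    by (simp add: W_def arcsine_weight_minus)
  then have "((\<lambda>t. h t * W t) has_integral I2) {-pi..0}"
    using has_integral_reflect_real[of "\<lambda>t. h t * W t" I2 0 "-pi"] by simp
  from has_integral_combine[OF _ _ this I1] show ?thesis
    using \<open>I = I1 + I2\<close> by (simp add: W_def add.commute)
qed

lemma arcsine_weight_mass:
  assumes "0 < r" "\<bar>M\<bar> + r \<le> 1"
  shows "(arcsine_weight M r has_integral 2 * pi) {-pi..pi}"
  using arcsine_weight_full[OF assms, of "\<lambda>_. 1" "2 * pi"] has_integral_const_real[of "2::real" 0 pi]
  by (simp add: mult.commute)

text \<open>Pairing \<open>l\<close> with \<open>- l\<close> turns the product of the two moduli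
  into that of \<open>1 - 2 * z * cos l + z^2\<close>, which factors after the cosine substitution.
  The factors in \<open>u\<close> have logarithmic mean 0, so exactly
  \<open>pi * ln (cmod C)\<close> remains.\<close>

lemma arcsine_log_potential_ge:
  assumes r: "0 < r" and M: "\<bar>M\<bar> + r \<le> 1" and z: "cmod z < 1"
  obtains I where "pi * ln r \<le> I"
    "((\<lambda>l. ln (cmod (1 - z * cis (- l))) * arcsine_weight M r l) has_integral I) {-pi..pi}"
proof -
  define h where "h = (\<lambda>l. ln (cmod (1 - z * cis (- l))))"
  have h: "continuous_on UNIV h"
    using continuous_log_one_minus[OF z, of UNIV "-1"] by (simp add: h_def)
  obtain u C where u: "cmod u < 1" and C: "r \<le> cmod C" and fac:
    "\<And>p. 1 - 2 * z * of_real (M + r * cos p) + z\<^sup>2 = C * (1 - u * cis p) * (1 - u * cis (- p))"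
    using joukowski_factorization[OF r M z] by blast
  define j where "j = (\<lambda>l. ln (cmod (1 - u * cis (- l))))"
  have split: "h (arccos (M + r * cos p)) + h (- arccos (M + r * cos p)) = ln (cmod C) + (j p + j (- p))" for p
  proof -
    define q where "q = arccos (M + r * cos p)"
    have "\<bar>r * cos p\<bar> \<le> r" using r by (simp add: abs_mult)
    then have "\<bar>M + r * cos p\<bar> \<le> 1" using M by linarith
    then have cosq: "cos q = M + r * cos p" unfolding q_def by (simp add: cos_arccos_abs)
    have cc: "cis (- q) * cis q = 1" "cis (- q) + cis q = 2 * of_real (cos q)"
      by (simp_all add: cis_mult complex_eq_iff)
    have "(1 - z * cis (- q)) * (1 - z * cis q) = 1 - z * (cis (- q) + cis q) + z\<^sup>2 * (cis (- q) * cis q)"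
      by (simp add: algebra_simps power2_eq_square)
    also have "\<dots> = C * (1 - u * cis p) * (1 - u * cis (- p))"
      unfolding cc cosq fac[symmetric] by simp
    finally have "cmod (1 - z * cis (- q)) * cmod (1 - z * cis q) =
        cmod C * cmod (1 - u * cis p) * cmod (1 - u * cis (- p))"
      by (metis norm_mult)
    then have "ln (cmod (1 - z * cis (- q)) * cmod (1 - z * cis q)) =
        ln (cmod C * cmod (1 - u * cis p) * cmod (1 - u * cis (- p)))"
      by simp
    moreover have "cmod C > 0" using C r by linarith
    ultimately show ?thesis
      using one_minus_disc_nonzero[OF z] one_minus_disc_nonzero[OF u]
      by (simp add: h_def j_def ln_mult q_def[symmetric])
  qed
  have "((\<lambda>p. j p + j (- p)) has_integral 0) {0..pi}"
    using log_one_minus_mean_zero[OF u] by (intro has_integral_fold_even) (auto simp: j_def)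
  from has_integral_add[OF has_integral_const_real[of "ln (cmod C)" 0 pi] this]
  have "((\<lambda>p. h (arccos (M + r * cos p)) + h (- arccos (M + r * cos p))) has_integral pi * ln (cmod C)) {0..pi}"
    by (simp add: split)
  from arcsine_weight_full[OF r M h this] show thesis
    using C r by (intro that[of "pi * ln (cmod C)"]) (auto simp: h_def intro!: ln_mono)
qed

lemma arcsine_weight_affine:
  assumes r: "0 < r" and M: "\<bar>M\<bar> + r \<le> 1" and k: "0 < k"
  shows "((\<lambda>l. arcsine_weight M r (real k * l - t)) has_integral 2 * pi) {-pi..pi}"
  using arcsine_weight_mass[OF r M] k arcsine_weight_periodic by (intro has_integral_periodic_affine)

text \<open>Averaging over the \<open>k\<close>-th roots of unity reduces this to the plain weight
  at the point \<open>z ^ k * cis (- t)\<close>, at the cost of a factor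
  \<open>1 / k\<close>.\<close>

lemma arcsine_log_potential_affine_ge:
  assumes r: "0 < r" and M: "\<bar>M\<bar> + r \<le> 1" and k: "0 < k" and z: "cmod z < 1"
  obtains I where "pi * ln r / real k \<le> I"
    "((\<lambda>l. ln (cmod (1 - z * cis (- l))) * arcsine_weight M r (real k * l - t)) has_integral I) {-pi..pi}"
proof -
  have "cmod (z ^ k * cis (- t)) < 1"
    using z k by (simp add: norm_mult norm_power power_less_one_iff)
  from arcsine_log_potential_ge[OF r M this] obtain I where I: "pi * ln r \<le> I"
    "((\<lambda>l. ln (cmod (1 - z ^ k * cis (- t) * cis (- l))) * arcsine_weight M r l) has_integral I) {-pi..pi}"
    by blast
  have "(\<lambda>l. arcsine_weight M r (real k * l - t)) absolutely_integrable_on {-pi..pi}"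
    using arcsine_weight_affine[OF r M k]
    by (auto intro!: nonnegative_absolutely_integrable_1 arcsine_weight_nonneg)
  then have "((\<lambda>l. ln (cmod (1 - z * cis (- l))) * arcsine_weight M r (real k * l - t))
      has_integral I / real k) {-pi..pi}"
    using arcsine_weight_periodic k z I by (intro has_integral_log_average)
  then show thesis using I(1) k by (intro that[of "I / real k"]) (auto simp: divide_right_mono)
qed

section \<open>Upper bound by Chebyshev polynomials\<close>

lemma spectral_density_integrable:
  assumes "spectral_density f"
  shows "f absolutely_integrable_on {-pi..pi}"
  using assms by (auto simp: spectral_density_def intro: nonnegative_absolutely_integrable_1)

section \<open>Competitors for \<open>sigma2\<close> as polynomials with value 1 at 0\<close>

definition prediction_poly :: "nat \<Rightarrow> (nat \<Rightarrow> complex) \<Rightarrow> complex poly" where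
  "prediction_poly n c = 1 - (\<Sum>j=1..n. monom (c j) j)"

lemma poly_prediction_poly:
  "poly (prediction_poly n c) (cis (- l)) = 1 - (\<Sum>j=1..n. c j * cis (- (real j * l)))"
  by (simp add: prediction_poly_def poly_sum poly_monom Complex.DeMoivre)

lemma poly_prediction_poly_0: "poly (prediction_poly n c) 0 = 1"
  by (simp add: prediction_poly_def poly_sum poly_monom)

lemma degree_prediction_poly: "degree (prediction_poly n c) \<le> n"
  unfolding prediction_poly_def
  by (intro degree_diff_le degree_sum_le) (auto intro: order_trans[OF degree_monom_le])

text \<open>This makes every polynomial of degree at most \<open>n\<close> with value 1 at 0 a
  competitor in the infimum.\<close>

lemma prediction_poly_surj:
  assumes "degree p \<le> n" "poly p 0 = 1"
  shows "prediction_poly n (\<lambda>j. - coeff p j) = p"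
proof (rule poly_eqI)
  fix i
  have "coeff p 0 = 1" using assms(2) by (simp add: poly_0_coeff_0)
  then show "coeff (prediction_poly n (\<lambda>j. - coeff p j)) i = coeff p i"
    using assms(1) by (cases "i = 0")
      (auto simp: prediction_poly_def coeff_sum coeff_monom sum.delta coeff_eq_0 sum_negf)
qed

lemma sigma2_eq_INF_poly:
  "sigma2 f n = (INF c. integral {-pi..pi} (\<lambda>l. (cmod (poly (prediction_poly n c) (cis (- l))))\<^sup>2 * f l))"
  by (simp add: sigma2_def poly_prediction_poly)

lemma poly_weight_integrable:
  assumes "spectral_density f"
  shows "(\<lambda>l. (cmod (poly p (cis (- l))))\<^sup>2 * f l) absolutely_integrable_on {-pi..pi}"
  by (rule absolutely_integrable_continuous_mult[OF _ spectral_density_integrable[OF assms]])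
     (intro continuous_intros)

text \<open>One competitor bounds the infimum. A bound on \<open>p\<close> where \<open>f\<close> is
  positive suffices, since the integrand vanishes elsewhere.\<close>

lemma sigma2_le:
  assumes sd: "spectral_density f" and p: "degree p \<le> n" "poly p 0 = 1"
    and B: "\<And>l. l \<in> {-pi..pi} \<Longrightarrow> 0 < f l \<Longrightarrow> cmod (poly p (cis (- l))) \<le> B"
  shows "sigma2 f n \<le> B\<^sup>2 * integral {-pi..pi} f"
proof -
  have nn: "0 \<le> f l" if "l \<in> {-pi..pi}" for l using sd that by (simp add: spectral_density_def)
  have int: "(\<lambda>l. (cmod (poly q (cis (- l))))\<^sup>2 * f l) integrable_on {-pi..pi}" for q
    using poly_weight_integrable[OF sd] set_lebesgue_integral_eq_integral(1) by blast
  have "sigma2 f n \<le> integral {-pi..pi} (\<lambda>l. (cmod (poly (prediction_poly n (\<lambda>j. - coeff p j)) (cis (- l))))\<^sup>2 * f l)"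
    unfolding sigma2_eq_INF_poly
    by (intro cINF_lower bdd_belowI2[of _ 0] integral_nonneg int) (use nn in auto)
  also have "\<dots> \<le> integral {-pi..pi} (\<lambda>l. B\<^sup>2 * f l)"
    unfolding prediction_poly_surj[OF p]
  proof (rule integral_le[OF int])
    show "(\<lambda>l. B\<^sup>2 * f l) integrable_on {-pi..pi}"
      using sd integrable_on_cmult_left[of f "{-pi..pi}" "B\<^sup>2"] by (simp add: spectral_density_def)
    fix l assume l: "l \<in> {-pi..pi}"
    show "(cmod (poly p (cis (- l))))\<^sup>2 * f l \<le> B\<^sup>2 * f l"
      using B[OF l] nn[OF l] by (cases "f l = 0") (auto intro!: mult_right_mono power_mono)
  qed
  finally show ?thesis by simp
qed

text \<open>\<open>2 (r v)^m T_m ((x - M) / r)\<close> for \<open>x = (v + 1/v) / 2\<close>, with \<open>T_m\<close> the Chebyshev polynomial.\<close>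

fun chebyshev_rev :: "real \<Rightarrow> real \<Rightarrow> nat \<Rightarrow> complex poly" where
  "chebyshev_rev M r 0 = [:2:]"
| "chebyshev_rev M r (Suc 0) = [:1, - 2 * of_real M, 1:]"
| "chebyshev_rev M r (Suc (Suc m)) = [:1, - 2 * of_real M, 1:] * chebyshev_rev M r (Suc m)
     - [:0, 0, of_real (r\<^sup>2):] * chebyshev_rev M r m"

lemma degree_chebyshev_rev: "degree (chebyshev_rev M r m) \<le> 2 * m"
proof (induction M r m rule: chebyshev_rev.induct)
  case (3 M r m)
  have "degree ([:1, - 2 * complex_of_real M, 1:] * chebyshev_rev M r (Suc m)) \<le> 2 + 2 * Suc m"
    using 3(1) by (intro order_trans[OF degree_mult_le] add_mono) auto
  moreover have "degree ([:0, 0, complex_of_real (r\<^sup>2):] * chebyshev_rev M r m) \<le> 2 + 2 * m"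
    using 3(2) by (intro order_trans[OF degree_mult_le] add_mono) auto
  ultimately show ?case by (auto intro!: degree_diff_le simp del: of_real_power)
qed auto

text \<open>The index 0 is excluded because the normalisation 2 T_0 = 2 gives the value 2
  there.\<close>

lemma poly_chebyshev_rev_0: "m > 0 \<Longrightarrow> poly (chebyshev_rev M r m) 0 = 1"
  by (induction M r m rule: chebyshev_rev.induct) auto

text \<open>At \<open>v = cis (- t)\<close> the quadratic \<open>1 - 2 * M * v + v^2\<close> equals
  \<open>2 * r * cos p * v\<close>, so the recursion becomes the three-term recurrence of
  \<open>cos (m * p)\<close>, scaled by powers of \<open>r * v\<close>.\<close>

lemma poly_chebyshev_rev_cis:
  assumes "cos t = M + r * cos p"
  shows "poly (chebyshev_rev M r m) (cis (- t)) = cis (- t) ^ m * of_real (2 * r ^ m * cos (real m * p))"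
proof -
  define v where "v = cis (- t)"
  have "v\<^sup>2 + 1 = v * (cis (- t) + cis t)"
    by (simp add: v_def power2_eq_square algebra_simps cis_mult)
  also have "cis (- t) + cis t = 2 * of_real (M + r * cos p)"
    by (simp add: complex_eq_iff assms)
  finally have v2: "1 - 2 * of_real M * v + v\<^sup>2 = 2 * of_real (r * cos p) * v"
    by (simp add: algebra_simps)
  have "poly (chebyshev_rev M r m) v = v ^ m * of_real (2 * r ^ m * cos (real m * p))"
    using v2 
  proof (induction M r m rule: chebyshev_rev.induct)
    case (2 M r)
    then show ?case by (simp add: algebra_simps power2_eq_square)
  next
    case (3 M r m)
    have cos: "cos (real (Suc (Suc m)) * p) = 2 * cos p * cos (real (Suc m) * p) - cos (real m * p)"
      using cos_add[of "real (Suc m) * p" p] cos_diff[of "real (Suc m) * p" p]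
      by (simp add: algebra_simps)
    have q1: "poly [:1, - 2 * of_real M, 1:] v = 2 * of_real (r * cos p) * v"
      using "3.prems" by (simp add: algebra_simps power2_eq_square)
    have q2: "poly [:0, 0, of_real (r\<^sup>2):] v = v\<^sup>2 * of_real (r\<^sup>2)"
      by (simp add: power2_eq_square)
    have "poly (chebyshev_rev M r (Suc (Suc m))) v =
      2 * of_real (r * cos p) * v * (v ^ Suc m * of_real (2 * r ^ Suc m * cos (real (Suc m) * p)))
      - v\<^sup>2 * of_real (r\<^sup>2) * (v ^ m * of_real (2 * r ^ m * cos (real m * p)))"
      by (simp only: chebyshev_rev.simps poly_diff poly_mult q1 q2 "3.IH"[OF "3.prems"])
    also have "\<dots> = v ^ Suc (Suc m) * of_real (2 * r ^ Suc (Suc m) *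
        (2 * cos p * cos (real (Suc m) * p) - cos (real m * p)))"
      by (simp add: algebra_simps power2_eq_square)
    finally show ?case by (simp only: cos)
  qed auto
  then show ?thesis by (simp add: v_def)
qed

lemma norm_chebyshev_rev_le:
  assumes r: "0 < r" and t: "\<bar>cos t - M\<bar> \<le> r"
  shows "cmod (poly (chebyshev_rev M r m) (cis (- t))) \<le> 2 * r ^ m"
proof -
  define p where "p = arccos ((cos t - M) / r)"
  have "\<bar>(cos t - M) / r\<bar> \<le> 1" using r t by (simp add: field_simps)
  then have "cos p = (cos t - M) / r" by (simp add: p_def cos_arccos_abs)
  then have "cos t = M + r * cos p" using r by simp
  from poly_chebyshev_rev_cis[OF this, of m]
  have "cmod (poly (chebyshev_rev M r m) (cis (- t))) = \<bar>2 * r ^ m * cos (real m * p)\<bar>"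
    by (simp only: norm_mult norm_power norm_cis norm_of_real) simp
  also have "\<dots> \<le> 2 * r ^ m"
    using r by (simp add: abs_mult)
  finally show ?thesis .
qed

lemma sigma2_upper:
  assumes sd: "spectral_density f" and r: "0 < r" and k: "0 < k" and m: "0 < m" and n: "2 * k * m \<le> n"
    and S: "\<And>l. l \<in> {-pi..pi} \<Longrightarrow> 0 < f l \<Longrightarrow> \<bar>cos (real k * l - t) - M\<bar> \<le> r"
  shows "sigma2 f n \<le> (2 * r ^ m)\<^sup>2 * integral {-pi..pi} f"
proof (rule sigma2_le[OF sd])
  \<comment> \<open>The inner monomial sends \<open>cis (- l)\<close> to
    \<open>cis (- (k * l - t))\<close>; it fixes 0, which keeps the value 1 there, and multiplies
    the degree by \<open>k\<close>.\<close>
  define p where "p = pcompose (chebyshev_rev M r m) (monom (cis t) k)"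
  have "degree p = degree (chebyshev_rev M r m) * k"
    by (simp add: p_def degree_pcompose degree_monom_eq)
  also have "\<dots> \<le> 2 * m * k" by (intro mult_right_mono degree_chebyshev_rev) auto
  finally show "degree p \<le> n" using n by (simp add: mult_ac)
  show "poly p 0 = 1"
    using k m by (simp add: p_def poly_pcompose poly_monom poly_chebyshev_rev_0 zero_power)
  fix l assume l: "l \<in> {-pi..pi}" "0 < f l"
  have "poly p (cis (- l)) = poly (chebyshev_rev M r m) (cis (- (real k * l - t)))"
    by (simp add: p_def poly_pcompose poly_monom Complex.DeMoivre cis_mult)
  then show "cmod (poly p (cis (- l))) \<le> 2 * r ^ m"
    using norm_chebyshev_rev_le[OF r S[OF l]] by simp
qed

section \<open>Lower bound by the equilibrium measure\<close>

text \<open>Jensen's inequality in its linearised form \<open>q \<ge> \<tau> (1 + ln q - ln \<tau>)\<close> with \<open>\<tau> = exp (L / G)\<close>.\<close>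

lemma integral_ge_exp_log_mean:
  fixes q g :: "'a \<Rightarrow> real"
  assumes g: "integrable M g" "\<And>x. x \<in> space M \<Longrightarrow> 0 \<le> g x" and G: "integral\<^sup>L M g = G" "0 < G"
    and q: "\<And>x. x \<in> space M \<Longrightarrow> 0 < q x" "integrable M (\<lambda>x. q x * g x)"
    and lq: "integrable M (\<lambda>x. ln (q x) * g x)" "L \<le> integral\<^sup>L M (\<lambda>x. ln (q x) * g x)"
  shows "G * exp (L / G) \<le> integral\<^sup>L M (\<lambda>x. q x * g x)"
proof -
  define \<tau> where "\<tau> = exp (L / G)"
  have "G * \<tau> = \<tau> * (1 - L / G) * G + \<tau> * L" using G(2) by (simp add: field_simps)
  also have "\<dots> \<le> \<tau> * (1 - L / G) * G + \<tau> * integral\<^sup>L M (\<lambda>x. ln (q x) * g x)"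
    using lq(2) by (simp add: \<tau>_def)
  also have "\<dots> = integral\<^sup>L M (\<lambda>x. \<tau> * (1 - L / G) * g x + \<tau> * (ln (q x) * g x))"
    using g(1) lq(1) G(1) by simp
  also have "\<dots> \<le> integral\<^sup>L M (\<lambda>x. q x * g x)"
  proof (rule integral_mono)
    show "integrable M (\<lambda>x. \<tau> * (1 - L / G) * g x + \<tau> * (ln (q x) * g x))"
      using g(1) lq(1) by simp
    fix x assume x: "x \<in> space M"
    have "ln (q x / \<tau>) \<le> q x / \<tau> - 1"
      using q(1)[OF x] by (intro ln_le_minus_one) (simp add: \<tau>_def)
    then have "1 - L / G + ln (q x) \<le> q x / \<tau>"
      using q(1)[OF x] by (simp add: \<tau>_def ln_div)
    then have "\<tau> * (1 - L / G + ln (q x)) \<le> q x" by (simp add: \<tau>_def field_simps)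
    then have "\<tau> * (1 - L / G + ln (q x)) * g x \<le> q x * g x"
      using g(2)[OF x] by (rule mult_right_mono)
    then show "\<tau> * (1 - L / G) * g x + \<tau> * (ln (q x) * g x) \<le> q x * g x"
      by (simp add: algebra_simps)
  qed (rule q(2))
  finally show ?thesis by (simp add: \<tau>_def)
qed

text \<open>The list holds the reciprocals of the zeros of a polynomial with value 1 at 0, with
  multiplicity; the product is its modulus at \<open>cis (- l)\<close>.\<close>

definition zero_prod :: "complex list \<Rightarrow> real \<Rightarrow> real" where
  "zero_prod zs l = prod_list (map (\<lambda>z. cmod (1 - z * cis (- l))) zs)"

lemma zero_prod_simps [simp]:
  "zero_prod [] l = 1" "zero_prod (z # zs) l = cmod (1 - z * cis (- l)) * zero_prod zs l"
  by (simp_all add: zero_prod_def)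

lemma zero_prod_nonneg: "0 \<le> zero_prod zs l"
  by (induction zs) auto

lemma zero_prod_le:
  assumes "\<And>z. z \<in> set zs \<Longrightarrow> cmod z \<le> 1"
  shows "zero_prod zs l \<le> 2 ^ length zs"
  using assms
proof (induction zs)
  case (Cons z zs)
  have "cmod (1 - z * cis (- l)) \<le> 2"
    using norm_triangle_ineq4[of 1 "z * cis (- l)"] Cons.prems[of z] by (simp add: norm_mult)
  then show ?case using Cons by (simp add: mult_mono zero_prod_nonneg)
qed auto

lemma zero_prod_pos:
  assumes "\<And>z. z \<in> set zs \<Longrightarrow> cmod z < 1"
  shows "0 < zero_prod zs l"
  using assms
proof (induction zs)
  case (Cons z zs)
  then show ?case using one_minus_disc_nonzero[of z "-l"] by (simp add: zero_less_mult_iff)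
qed simp

lemma continuous_zero_prod: "continuous_on S (\<lambda>l. zero_prod zs l)"
proof (induction zs)
  case (Cons z zs)
  then show ?case by (simp, intro continuous_intros)
qed simp

lemma arcsine_log_zero_prod_ge:
  assumes r: "0 < r" and M: "\<bar>M\<bar> + r \<le> 1" and k: "0 < k"
    and zs: "\<And>z. z \<in> set zs \<Longrightarrow> cmod z < 1" 
  shows "\<exists>I\<ge>real (length zs) * (pi * ln r / real k).
    ((\<lambda>l. ln (zero_prod zs l) * arcsine_weight M r (real k * l - t)) has_integral I) {-pi..pi}"
  using zs
proof (induction zs)
  case Nil
  then show ?case by auto
next
  case (Cons z zs)
  then have z: "cmod z < 1" by simp
  from Cons obtain I where I: "real (length zs) * (pi * ln r / real k) \<le> I"
    "((\<lambda>l. ln (zero_prod zs l) * arcsine_weight M r (real k * l - t)) has_integral I) {-pi..pi}"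
    by auto
  obtain J where J: "pi * ln r / real k \<le> J"
    "((\<lambda>l. ln (cmod (1 - z * cis (- l))) * arcsine_weight M r (real k * l - t)) has_integral J) {-pi..pi}"
    using arcsine_log_potential_affine_ge[OF r M k z] by blast
  have "ln (zero_prod (z # zs) l) = ln (cmod (1 - z * cis (- l))) + ln (zero_prod zs l)" for l
    using zero_prod_pos[of zs l] Cons.prems one_minus_disc_nonzero[OF z, of "-l"]
    by (simp add: ln_mult)
  moreover have "real (length (z # zs)) * (pi * ln r / real k) \<le> J + I"
    using I(1) J(1) by (simp only: length_Cons of_nat_Suc distrib_right)
  ultimately show ?case using has_integral_add[OF J(2) I(2)]
    by (intro exI[of _ "J + I"]) (simp add: distrib_right)
qed

abbreviation circle_measure :: "real measure" where
  "circle_measure \<equiv> lebesgue_on {-pi..pi}"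

lemma circle_integrable_continuous_mult:
  fixes g f :: "real \<Rightarrow> real"
  assumes "continuous_on {-pi..pi} g" "integrable circle_measure f"
  shows "integrable circle_measure (\<lambda>x. g x * f x)"
proof -
  have "f absolutely_integrable_on {-pi..pi}"
    using assms(2) by (simp add: set_integrable_eq)
  from absolutely_integrable_continuous_mult[OF assms(1) this]
  show ?thesis by (simp add: set_integrable_eq)
qed

lemma circle_integral_eq:
  assumes "(f has_integral I) {-pi..pi}" "integrable circle_measure f"
  shows "integral\<^sup>L circle_measure f = (I::real)"
  using lebesgue_integral_eq_integral[OF assms(2)] assms(1) by (simp add: integral_unique)

text \<open>The log-mean against \<open>g\<close> is the one against \<open>W\<close> minus the one
  against \<open>W - g\<close>. The potential estimate bounds the former from below; the latter is
  at most \<open>2 * n * ln 2\<close> times the lost mass \<open>2 * pi - G\<close>. Jensen's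
  inequality and \<open>g <= m * f\<close> then finish. Points in the open disc keep the logarithm
  continuous.\<close>

lemma zero_prod_open_disc_lower:
  fixes f g :: "real \<Rightarrow> real" and M r t :: real and k :: nat
  defines "W \<equiv> \<lambda>l. arcsine_weight M r (real k * l - t)"
  assumes r: "0 < r" and M: "\<bar>M\<bar> + r \<le> 1" and k: "0 < k"
    and f: "integrable circle_measure f" and m: "0 < m"
    and g: "integrable circle_measure g"
    and gb: "\<And>l. l \<in> {-pi..pi} \<Longrightarrow> 0 \<le> g l \<and> g l \<le> W l \<and> g l \<le> m * f l"
    and G: "integral\<^sup>L circle_measure g = G" "0 < G"
    and zs: "\<And>z. z \<in> set zs \<Longrightarrow> cmod z < 1" and n: "length zs \<le> n"
  shows "G / m * exp (2 * real n * (pi * ln r / real k - (2 * pi - G) * ln 2) / G)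
    \<le> integral\<^sup>L circle_measure (\<lambda>l. (zero_prod zs l)\<^sup>2 * f l)"
proof -
  define q where "q = (\<lambda>l. (zero_prod zs l)\<^sup>2)"
  have zpos: "0 < zero_prod zs l" for l using zs by (rule zero_prod_pos)
  have qpos: "0 < q l" for l using zpos[of l] by (simp add: q_def)
  have contq: "continuous_on {-pi..pi} q"
    unfolding q_def by (intro continuous_intros continuous_zero_prod)
  have contl: "continuous_on {-pi..pi} (\<lambda>l. ln (q l))"
    using zpos by (intro continuous_intros contq) (auto simp: q_def less_imp_neq[THEN not_sym])
  have lnq: "ln (q l) = 2 * ln (zero_prod zs l)" for l
    using zpos[of l] by (simp add: q_def ln_realpow)
  have W: "(W has_integral 2 * pi) {-pi..pi}"
    unfolding W_def by (rule arcsine_weight_affine[OF r M k])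
  have Wint: "integrable circle_measure W"
    using nonnegative_absolutely_integrable_1[of W "{-pi..pi}"] W arcsine_weight_nonneg
    by (auto simp: W_def set_integrable_eq)
  have W2: "integral\<^sup>L circle_measure W = 2 * pi" by (rule circle_integral_eq[OF W Wint])
  obtain I where I: "real (length zs) * (pi * ln r / real k) \<le> I"
    "((\<lambda>l. ln (zero_prod zs l) * W l) has_integral I) {-pi..pi}"
    using arcsine_log_zero_prod_ge[OF r M k, of zs t] zs unfolding W_def by metis
  have lW: "integral\<^sup>L circle_measure (\<lambda>l. ln (q l) * W l) = 2 * I"
  proof (rule circle_integral_eq)
    show "((\<lambda>l. ln (q l) * W l) has_integral 2 * I) {-pi..pi}"
      using has_integral_mult_right[OF I(2), of 2] by (simp add: lnq mult.assoc)
  qed (rule circle_integrable_continuous_mult[OF contl Wint])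
  have rest: "integral\<^sup>L circle_measure (\<lambda>l. ln (q l) * (W l - g l)) \<le> 2 * real n * ln 2 * (2 * pi - G)"
  proof -
    have "integral\<^sup>L circle_measure (\<lambda>l. ln (q l) * (W l - g l))
        \<le> integral\<^sup>L circle_measure (\<lambda>l. 2 * real n * ln 2 * (W l - g l))"
    proof (rule integral_mono)
      show "integrable circle_measure (\<lambda>l. ln (q l) * (W l - g l))"
        using circle_integrable_continuous_mult[OF contl, of "\<lambda>l. W l - g l"] Wint g by simp
      show "integrable circle_measure (\<lambda>l. 2 * real n * ln 2 * (W l - g l))"
        using Wint g by simp
      fix l assume "l \<in> space circle_measure"
      then have l: "l \<in> {-pi..pi}" by simp
      have "zero_prod zs l \<le> 2 ^ n"
        using zero_prod_le[of zs l] zs n power_increasing[of "length zs" n "2::real"]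
        by (meson less_imp_le one_le_numeral order_trans)
      then have "ln (zero_prod zs l) \<le> ln (2 ^ n)"
        using zpos[of l] by (subst ln_le_cancel_iff) auto
      then have "ln (q l) \<le> 2 * real n * ln 2" by (simp add: lnq ln_realpow)
      then show "ln (q l) * (W l - g l) \<le> 2 * real n * ln 2 * (W l - g l)"
        using gb[OF l] by (intro mult_right_mono) auto
    qed
    also have "\<dots> = 2 * real n * ln 2 * (2 * pi - G)"
      using Wint g by (simp add: W2 G)
    finally show ?thesis .
  qed
  \<comment> \<open>As the potential bound is nonpositive, passing from the length of
    \<open>zs\<close> to the larger \<open>n\<close> only weakens the estimate.\<close>
  have "ln r \<le> 0" using r M by (simp add: ln_le_zero_iff)
  then have nlen: "real n * (pi * ln r / real k) \<le> real (length zs) * (pi * ln r / real k)"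
    using n by (intro mult_right_mono_neg) (auto simp: mult_nonneg_nonpos divide_nonpos_nonneg)
  have "2 * real n * (pi * ln r / real k - (2 * pi - G) * ln 2)
      \<le> 2 * I - 2 * real n * ln 2 * (2 * pi - G)"
  proof -
    have "2 * real n * (x - y * ln 2) = 2 * (real n * x) - 2 * real n * ln 2 * y" for x y
      by (simp add: algebra_simps)
    then show ?thesis using I(1) nlen by (simp only:)
  qed
  also have "\<dots> \<le> integral\<^sup>L circle_measure (\<lambda>l. ln (q l) * W l)
      - integral\<^sup>L circle_measure (\<lambda>l. ln (q l) * (W l - g l))"
    using rest lW by simp
  also have "\<dots> = integral\<^sup>L circle_measure (\<lambda>l. ln (q l) * W l - ln (q l) * (W l - g l))"
    by (subst Bochner_Integration.integral_diff)
       (use circle_integrable_continuous_mult[OF contl] Wint g in auto)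
  also have "\<dots> = integral\<^sup>L circle_measure (\<lambda>l. ln (q l) * g l)"
    by (simp add: algebra_simps)
  finally have L: "2 * real n * (pi * ln r / real k - (2 * pi - G) * ln 2)
      \<le> integral\<^sup>L circle_measure (\<lambda>l. ln (q l) * g l)" .
  have "G * exp (2 * real n * (pi * ln r / real k - (2 * pi - G) * ln 2) / G)
      \<le> integral\<^sup>L circle_measure (\<lambda>l. q l * g l)"
    by (rule integral_ge_exp_log_mean[OF g _ G _ _ _ L])
       (use gb qpos circle_integrable_continuous_mult[OF contl g]
          circle_integrable_continuous_mult[OF contq g] in auto)
  also have "\<dots> \<le> integral\<^sup>L circle_measure (\<lambda>l. m * (q l * f l))"
  proof (rule integral_mono)
    fix l assume "l \<in> space circle_measure"
    then have "g l \<le> m * f l" using gb by simp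
    then have "q l * g l \<le> q l * (m * f l)" by (intro mult_left_mono) (auto simp: q_def)
    then show "q l * g l \<le> m * (q l * f l)" by (simp add: mult_ac)
  qed (use circle_integrable_continuous_mult[OF contq] g f in auto)
  also have "\<dots> = m * integral\<^sup>L circle_measure (\<lambda>l. q l * f l)" by simp
  finally show ?thesis using m by (simp add: q_def field_simps)
qed

text \<open>Points on the unit circle are reached as limits: contracting the list by factors
  \<open>s i < 1\<close> tending to 1 keeps its length, and dominated convergence carries the bound
  over.\<close>

lemma zero_prod_closed_disc_lower:
  assumes f: "integrable circle_measure f" "\<And>l. l \<in> {-pi..pi} \<Longrightarrow> 0 \<le> f l"
    and zs: "\<And>z. z \<in> set zs \<Longrightarrow> cmod z \<le> 1"
    and low: "\<And>ws. length ws = length zs \<Longrightarrow> (\<And>z. z \<in> set ws \<Longrightarrow> cmod z < 1) \<Longrightarrow>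
       B \<le> integral\<^sup>L circle_measure (\<lambda>l. (zero_prod ws l)\<^sup>2 * f l)"
  shows "B \<le> integral\<^sup>L circle_measure (\<lambda>l. (zero_prod zs l)\<^sup>2 * f l)"
proof -
  define s where "s = (\<lambda>i::nat. 1 - 1 / real (Suc i))"
  define ws where "ws = (\<lambda>i. map (\<lambda>z. of_real (s i) * z) zs)"
  have s1: "s \<longlonglongrightarrow> 1"
    using tendsto_diff[OF tendsto_const[of "1::real"] LIMSEQ_inverse_real_of_nat]
    by (simp add: s_def divide_inverse)
  have s: "0 \<le> s i" "s i < 1" for i by (auto simp: s_def)
  have wslt: "cmod w < 1" if "w \<in> set (ws i)" for w i
  proof -
    from that obtain z where "z \<in> set zs" "w = of_real (s i) * z" by (auto simp: ws_def)
    then have "cmod w = s i * cmod z" "cmod z \<le> 1" using s zs by (auto simp: norm_mult)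
    then show ?thesis using s[of i] mult_left_mono[of "cmod z" 1 "s i"] by linarith
  qed
  have lim: "(\<lambda>i. zero_prod (ws i) l) \<longlonglongrightarrow> zero_prod zs l" for l
    unfolding ws_def
  proof (induction zs)
    case (Cons z zs)
    have "(\<lambda>i. cmod (1 - of_real (s i) * z * cis (- l))) \<longlonglongrightarrow> cmod (1 - of_real 1 * z * cis (- l))"
      by (intro tendsto_intros s1)
    then show ?case using Cons by (auto intro: tendsto_mult)
  qed auto
  have contq: "continuous_on {-pi..pi} (\<lambda>l. (zero_prod us l)\<^sup>2)" for us
    by (intro continuous_intros continuous_zero_prod)
  note int = circle_integrable_continuous_mult[OF contq f(1)]
  have "(\<lambda>i. integral\<^sup>L circle_measure (\<lambda>l. (zero_prod (ws i) l)\<^sup>2 * f l))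
      \<longlonglongrightarrow> integral\<^sup>L circle_measure (\<lambda>l. (zero_prod zs l)\<^sup>2 * f l)"
  proof (rule integral_dominated_convergence[where w = "\<lambda>l. (2 ^ length zs)\<^sup>2 * f l"])
    show "AE l in circle_measure. (\<lambda>i. (zero_prod (ws i) l)\<^sup>2 * f l) \<longlonglongrightarrow> (zero_prod zs l)\<^sup>2 * f l"
      by (intro AE_I2 tendsto_intros lim)
    fix i
    show "AE l in circle_measure. norm ((zero_prod (ws i) l)\<^sup>2 * f l) \<le> (2 ^ length zs)\<^sup>2 * f l"
    proof (rule AE_I2)
      fix l assume "l \<in> space circle_measure"
      then have "0 \<le> f l" using f(2) by simp
      moreover have "zero_prod (ws i) l \<le> 2 ^ length zs"
      proof -
        have "zero_prod (ws i) l \<le> 2 ^ length (ws i)"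
          by (rule zero_prod_le) (rule less_imp_le[OF wslt])
        then show ?thesis by (simp add: ws_def)
      qed
      ultimately show "norm ((zero_prod (ws i) l)\<^sup>2 * f l) \<le> (2 ^ length zs)\<^sup>2 * f l"
        by (auto simp: abs_mult zero_prod_nonneg intro!: mult_right_mono power_mono)
    qed
  qed (use int f(1) in auto)
  moreover have "B \<le> integral\<^sup>L circle_measure (\<lambda>l. (zero_prod (ws i) l)\<^sup>2 * f l)" for i
    by (rule low) (use wslt in \<open>auto simp: ws_def\<close>)
  ultimately show ?thesis by (intro LIMSEQ_le_const) auto
qed

text \<open>A point outside the closed disc is reflected to \<open>1 / cnj z\<close>; on the circle
  this divides its factor by \<open>cmod z > 1\<close>.\<close>

lemma zero_prod_reflect:
  "\<exists>ws. length ws = length zs \<and> (\<forall>z\<in>set ws. cmod z \<le> 1) \<and> (\<forall>l. zero_prod ws l \<le> zero_prod zs l)"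
proof (induction zs)
  case (Cons z zs)
  then obtain ws where ws: "length ws = length zs" "\<forall>z\<in>set ws. cmod z \<le> 1"
    "\<forall>l. zero_prod ws l \<le> zero_prod zs l" by blast
  define w where "w = (if cmod z \<le> 1 then z else 1 / cnj z)"
  have "cmod w \<le> 1" by (simp add: w_def norm_divide divide_le_eq_1)
  moreover have "cmod (1 - w * cis (- l)) \<le> cmod (1 - z * cis (- l))" for l
  proof (cases "cmod z \<le> 1")
    case False
    then have z0: "z \<noteq> 0" by auto
    have "cmod (1 - z * cis (- l)) = cmod (cnj (1 - z * cis (- l)))" by (simp only: complex_mod_cnj)
    also have "cnj (1 - z * cis (- l)) = - cnj z * cis l * (1 - w * cis (- l))"
      using z0 False by (simp add: w_def cis_cnj algebra_simps cis_mult)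
    also have "cmod \<dots> = cmod z * cmod (1 - w * cis (- l))"
      by (simp add: norm_mult)
    finally show ?thesis using False mult_right_mono[of 1 "cmod z" "cmod (1 - w * cis (- l))"] by simp
  qed (simp add: w_def)
  ultimately show ?case using ws
    by (intro exI[of _ "w # ws"]) (auto intro!: mult_mono zero_prod_nonneg)
qed auto

text \<open>Splitting into linear factors and pulling \<open>- x\<close> out of each root factor
  leaves the constant \<open>poly p 0 = 1\<close>, which also shows that no root is 0.\<close>

lemma poly_eq_zero_prod:
  assumes "poly p (0::complex) = 1"
  obtains zs where "length zs = degree p" "\<And>l. cmod (poly p (cis (- l))) = zero_prod zs l"
proof -
  have "p \<noteq> 0" using assms by auto
  then obtain A where A: "size A = degree p" "p = smult (lead_coeff p) (\<Prod>x\<in>#A. [:-x, 1:])"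
    using alg_closed_imp_factorization by blast
  obtain xs where xs: "mset xs = A" using ex_mset by blast
  have pv: "poly p v = lead_coeff p * prod_list (map (\<lambda>x. v - x) xs)" for v
  proof -
    have "poly (prod_list (map (\<lambda>x. [:-x, 1:]) xs)) v = prod_list (map (\<lambda>x. v - x) xs)"
      by (induction xs) (auto simp: algebra_simps)
    moreover have "(\<Prod>x\<in>#A. [:-x, 1:]) = prod_list (map (\<lambda>x. [:-x, 1:]) xs)"
      using xs by (metis mset_map prod_mset_prod_list)
    ultimately show ?thesis by (subst A(2)) simp
  qed
  have one: "lead_coeff p * prod_list (map (\<lambda>x. - x) xs) = 1"
    using pv[of 0] assms by simp
  have nz: "0 \<notin> set xs"
  proof
    assume "0 \<in> set xs"
    then have "prod_list (map (\<lambda>x. - x) xs) = 0" by (auto simp: prod_list_zero_iff)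
    then show False using one by simp
  qed
  have fac: "prod_list (map (\<lambda>x. v - x) xs) = prod_list (map (\<lambda>x. - x) xs) * prod_list (map (\<lambda>x. 1 - 1 / x * v) xs)" for v
    using nz by (induction xs) (auto simp: field_simps)
  show thesis
  proof (rule that[of "map (\<lambda>x. 1 / x) xs"])
    show "length (map (\<lambda>x. 1 / x) xs) = degree p" using A(1) xs by auto
    fix l
    have "poly p (cis (- l)) = prod_list (map (\<lambda>x. 1 - 1 / x * cis (- l)) xs)"
      using one by (simp add: pv fac mult.assoc[symmetric])
    moreover have "cmod (prod_list (map (\<lambda>x. 1 - 1 / x * cis (- l)) xs)) = zero_prod (map (\<lambda>x. 1 / x) xs) l"
      by (induction xs) (auto simp: norm_mult)
    ultimately show "cmod (poly p (cis (- l))) = zero_prod (map (\<lambda>x. 1 / x) xs) l" by simp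
  qed
qed

text \<open>The truncations \<open>g m\<close> converge to \<open>W\<close> almost everywhere under
  the majorant \<open>W\<close>, so the exponent \<open>\<kappa> m\<close> tends to
  \<open>ln r / (2 * k)\<close>. A single \<open>m\<close> with \<open>a < \<kappa> m\<close> serves
  all \<open>n\<close>, which makes the constant \<open>G m / m\<close> independent of
  \<open>n\<close>.\<close>

lemma sigma2_lower:
  fixes f :: "real \<Rightarrow> real" and M r t a :: real and k :: nat
  assumes sd: "spectral_density f" and r: "0 < r" and M: "\<bar>M\<bar> + r \<le> 1" and k: "0 < k"
    and pos: "AE l in lebesgue. l \<in> {-pi..pi} \<longrightarrow> \<bar>cos (real k * l - t) - M\<bar> < r \<longrightarrow> 0 < f l"
    and a: "a < ln r / (2 * real k)"
  shows "\<exists>c>0. \<forall>n. c * exp (2 * real n * a) \<le> sigma2 f n"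
proof -
  define W where "W = (\<lambda>l. arcsine_weight M r (real k * l - t))"
  define g where "g = (\<lambda>m l. min (real m * f l) (W l))"
  define G where "G = (\<lambda>m. integral\<^sup>L circle_measure (g m))"
  define \<kappa> where "\<kappa> = (\<lambda>m. (pi * ln r / real k - (2 * pi - G m) * ln 2) / G m)"
  have fnn: "0 \<le> f l" if "l \<in> {-pi..pi}" for l using sd that by (simp add: spectral_density_def)
  have f: "integrable circle_measure f"
    using spectral_density_integrable[OF sd] by (simp add: set_integrable_eq)
  have W: "(W has_integral 2 * pi) {-pi..pi}"
    unfolding W_def by (rule arcsine_weight_affine[OF r M k])
  have Wnn: "0 \<le> W l" for l by (simp add: W_def arcsine_weight_nonneg)
  have Wint: "integrable circle_measure W"
    using nonnegative_absolutely_integrable_1[of W "{-pi..pi}"] W Wnn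
    by (auto simp: set_integrable_eq)
  have W2: "integral\<^sup>L circle_measure W = 2 * pi" by (rule circle_integral_eq[OF W Wint])
  have gint: "integrable circle_measure (g m)" for m
    unfolding g_def using f Wint by (intro integrable_min) auto
  have "AE l in circle_measure. \<bar>cos (real k * l - t) - M\<bar> < r \<longrightarrow> 0 < f l"
    using pos by (simp add: AE_restrict_space_iff)
  moreover have "AE l in circle_measure. 0 \<le> f l" using fnn by (intro AE_I2) simp
  ultimately have conv: "AE l in circle_measure. (\<lambda>m. g m l) \<longlonglongrightarrow> W l"
  proof (eventually_elim)
    case (elim l)
    show ?case
    proof (cases "0 < f l")
      case True
      have "eventually (\<lambda>m. W l / f l \<le> real m) sequentially"
        using filterlim_real_sequentially by (simp add: filterlim_at_top)
      then have "eventually (\<lambda>m. g m l = W l) sequentially"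
        by eventually_elim (use True in \<open>simp add: g_def field_simps\<close>)
      then show ?thesis by (rule tendsto_eventually)
    next
      case False
      then have "W l = 0"
        using elim arcsine_weight_pos_imp[of M r "real k * l - t"] Wnn[of l] by (force simp: W_def)
      moreover have "f l = 0" using False elim by simp
      ultimately show ?thesis by (simp add: g_def)
    qed
  qed
  have "G \<longlonglongrightarrow> 2 * pi"
    unfolding G_def W2[symmetric]
  proof (rule integral_dominated_convergence[where w = W])
    show "AE l in circle_measure. norm (g m l) \<le> W l" for m
      using fnn Wnn by (intro AE_I2) (auto simp: g_def abs_of_nonneg)
  qed (use conv gint Wint in auto)
  then have "\<kappa> \<longlonglongrightarrow> (pi * ln r / real k - (2 * pi - 2 * pi) * ln 2) / (2 * pi)"
    unfolding \<kappa>_def by (intro tendsto_intros) auto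
  also have "(pi * ln r / real k - (2 * pi - 2 * pi) * ln 2) / (2 * pi) = ln r / (2 * real k)"
    using k by (simp add: field_simps)
  finally have "eventually (\<lambda>m. a < \<kappa> m) sequentially" using a order_tendstoD(1) by blast
  moreover have "eventually (\<lambda>m. 0 < G m) sequentially"
    using \<open>G \<longlonglongrightarrow> 2 * pi\<close> by (rule order_tendstoD(1)) auto
  moreover have "eventually (\<lambda>m. 0 < m) sequentially" by (rule eventually_gt_at_top)
  ultimately have "eventually (\<lambda>m. a < \<kappa> m \<and> 0 < G m \<and> 0 < m) sequentially"
    by eventually_elim auto
  then obtain m where m: "a < \<kappa> m" "0 < G m" "0 < m"
    using eventually_happens trivial_limit_sequentially by blast
  have "G m / real m * exp (2 * real n * a) \<le> sigma2 f n" for n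
    unfolding sigma2_eq_INF_poly
  proof (rule cINF_greatest)
    fix c
    define p where "p = prediction_poly n c"
    obtain zs where zs: "length zs = degree p" "\<And>l. cmod (poly p (cis (- l))) = zero_prod zs l"
      using poly_eq_zero_prod[of p] poly_prediction_poly_0 unfolding p_def by blast
    obtain ws where ws: "length ws = length zs" "\<And>z. z \<in> set ws \<Longrightarrow> cmod z \<le> 1"
      "\<And>l. zero_prod ws l \<le> zero_prod zs l"
      using zero_prod_reflect[of zs] by blast
    have len: "length ws \<le> n" using zs ws degree_prediction_poly by (simp add: p_def)
    have cont: "continuous_on {-pi..pi} (\<lambda>l. (zero_prod us l)\<^sup>2)" for us
      by (intro continuous_intros continuous_zero_prod)
    note int = circle_integrable_continuous_mult[OF cont f]
    have "2 * real n * a \<le> 2 * real n * \<kappa> m" using m(1) by (simp add: mult_left_mono)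
    then have "G m / real m * exp (2 * real n * a) \<le> G m / real m * exp (2 * real n * \<kappa> m)"
      using m by (intro mult_left_mono) auto
    also have "\<dots> = G m / real m * exp (2 * real n * (pi * ln r / real k - (2 * pi - G m) * ln 2) / G m)"
      by (simp add: \<kappa>_def)
    also have "\<dots> \<le> integral\<^sup>L circle_measure (\<lambda>l. (zero_prod ws l)\<^sup>2 * f l)"
    proof (rule zero_prod_closed_disc_lower[OF f fnn ws(2)])
      fix vs :: "complex list"
      assume vs: "length vs = length ws" "\<And>z. z \<in> set vs \<Longrightarrow> cmod z < 1"
      show "G m / real m * exp (2 * real n * (pi * ln r / real k - (2 * pi - G m) * ln 2) / G m)
          \<le> integral\<^sup>L circle_measure (\<lambda>l. (zero_prod vs l)\<^sup>2 * f l)"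
        by (rule zero_prod_open_disc_lower[where t = t, OF r M k f _ gint _ _ m(2) vs(2)])
           (use m fnn Wnn vs len in \<open>auto simp: g_def G_def W_def\<close>)
    qed auto
    also have "\<dots> \<le> integral\<^sup>L circle_measure (\<lambda>l. (zero_prod zs l)\<^sup>2 * f l)"
      by (rule integral_mono[OF int int])
         (use ws(3) fnn in \<open>auto intro!: mult_right_mono power_mono zero_prod_nonneg\<close>)
    also have "\<dots> = integral {-pi..pi} (\<lambda>l. (cmod (poly (prediction_poly n c) (cis (- l))))\<^sup>2 * f l)"
      by (subst lebesgue_integral_eq_integral[OF int]) (simp_all add: zs(2)[symmetric] p_def)
    finally show "G m / real m * exp (2 * real n * a) \<le> \<dots>" .
  qed auto
  then show ?thesis using m by (intro exI[of _ "G m / real m"]) auto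
qed

section \<open>The limit for the four families of arcs\<close>

text \<open>Both bounds are geometric up to constants independent of \<open>n\<close>, and the
  \<open>n\<close>-th root of a positive constant tends to 1.\<close>

lemma root_sigma_tendsto:
  fixes f :: "real \<Rightarrow> real" and M r t :: real and k :: nat
  assumes sd: "spectral_density f" and r: "0 < r" and M: "\<bar>M\<bar> + r \<le> 1" and k: "0 < k"
    and S: "\<And>l. l \<in> {-pi..pi} \<Longrightarrow> 0 < f l \<Longrightarrow> \<bar>cos (real k * l - t) - M\<bar> \<le> r"
    and pos: "AE l in lebesgue. l \<in> {-pi..pi} \<longrightarrow> \<bar>cos (real k * l - t) - M\<bar> < r \<longrightarrow> 0 < f l"
  shows "(\<lambda>n. root n (sigma f n)) \<longlonglongrightarrow> r powr (1 / (2 * real k))"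
proof -
  define L where "L = r powr (1 / (2 * real k))"
  have L: "0 < L" using r by (simp add: L_def)
  have lnL: "ln L = ln r / (2 * real k)" using r by (simp add: L_def ln_powr)
  have root_const: "(\<lambda>n. root n C * w) \<longlonglongrightarrow> w" if "0 < C" for C w :: real
    using tendsto_mult[OF LIMSEQ_root_const[OF that] tendsto_const[of w]] by simp
  have "(\<lambda>n. root n (sigma f n)) \<longlonglongrightarrow> L"
  proof (rule order_tendstoI)
    fix y assume "y < L"
    \<comment> \<open>Staying above 0 makes \<open>ln w\<close> meaningful, while
      \<open>w < L\<close> leaves room for the loss in the lower bound.\<close>
    then obtain w where w: "max y 0 < w" "w < L" using dense[of "max y 0" L] L by auto
    then have "ln w < ln r / (2 * real k)" unfolding lnL[symmetric] by (subst ln_less_cancel_iff) auto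
    from sigma2_lower[OF sd r M k pos this]
    obtain c where c: "c > 0" "\<And>n. c * exp (2 * real n * ln w) \<le> sigma2 f n" by blast
    have "sqrt c * w ^ n \<le> sigma f n" for n
    proof -
      have "exp (2 * real n * ln w) = (w ^ n)\<^sup>2"
        using w exp_of_nat_mult[of "2 * n" "ln w"] by (simp add: power_mult[symmetric] mult.commute)
      then have "sqrt (c * (w ^ n)\<^sup>2) \<le> sigma f n"
        unfolding sigma_def using c(2)[of n] by simp
      then show ?thesis using w by (simp add: real_sqrt_mult)
    qed
    then have low: "root n (sqrt c) * w \<le> root n (sigma f n)" if "n > 0" for n
      using real_root_le_mono[OF that, of "sqrt c * w ^ n" "sigma f n"] that w
      by (simp add: real_root_mult real_root_power_cancel)
    have "eventually (\<lambda>n. y < root n (sqrt c) * w) sequentially"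
      using root_const[of "sqrt c" w] c w by (intro order_tendstoD(1)) auto
    then show "eventually (\<lambda>n. y < root n (sigma f n)) sequentially"
      using eventually_gt_at_top[of 0] by eventually_elim (rule less_le_trans[OF _ low])
  next
    fix y assume y: "L < y"
    define I where "I = integral {-pi..pi} f"
    \<comment> \<open>The factor \<open>1 / r\<close> pays for rounding \<open>n / (2 * k)\<close>
      down to an integer; the summand 1 gives \<open>0 < C\<close> from \<open>0 <= I\<close>
      alone.\<close>
    define C where "C = 2 * sqrt I / r + 1"
    have "0 \<le> I" unfolding I_def using sd by (intro integral_nonneg) (auto simp: spectral_density_def)
    then have C: "0 < C" using r by (simp add: C_def add_nonneg_pos)
    have up: "sigma f n \<le> C * L ^ n" if n: "2 * k \<le> n" for n
    proof -
      define m where "m = n div (2 * k)"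
      have m: "0 < m" "2 * k * m \<le> n" using n k by (auto simp: m_def div_greater_zero_iff)
      have "n < 2 * k * (m + 1)"
        using k dividend_less_times_div[of "2 * k" n] by (simp add: m_def)
      then have "real n < real (2 * k * (m + 1))" by (simp only: of_nat_less_iff)
      then have "real n / (2 * real k) \<le> real m + 1" using k by (simp add: field_simps)
      then have "r powr (real m + 1) \<le> r powr (real n / (2 * real k))"
        using r M by (intro powr_mono') auto
      also have "\<dots> = L ^ n" using r by (simp add: L_def powr_realpow[symmetric] powr_powr)
      finally have rm: "r ^ m \<le> L ^ n / r" using r by (simp add: powr_add powr_realpow field_simps)
      have "sigma f n \<le> sqrt ((2 * r ^ m)\<^sup>2 * I)"
        unfolding sigma_def I_def using sigma2_upper[OF sd r k m S] by simp
      also have "\<dots> = 2 * r ^ m * sqrt I" using r by (simp add: real_sqrt_mult)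
      also have "\<dots> \<le> 2 * (L ^ n / r) * sqrt I"
        using rm \<open>0 \<le> I\<close> by (intro mult_right_mono) auto
      also have "\<dots> \<le> C * L ^ n" using L by (simp add: C_def algebra_simps)
      finally show ?thesis .
    qed
    have high: "root n (sigma f n) \<le> root n C * L" if "2 * k \<le> n" for n
    proof -
      have n: "0 < n" using that k by linarith
      show ?thesis using real_root_le_mono[OF n up[OF that]] n L
        by (simp add: real_root_mult real_root_power_cancel)
    qed
    have "eventually (\<lambda>n. root n C * L < y) sequentially"
      using root_const[OF C, of L] y by (rule order_tendstoD(2))
    then show "eventually (\<lambda>n. root n (sigma f n) < y) sequentially"
      using eventually_ge_at_top[of "2 * k"] by eventually_elim (rule le_less_trans[OF high])
  qed
  then show ?thesis by (simp add: L_def)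
qed

text \<open>Subtracting the nearest multiple of \<open>2 * pi\<close> brings the absolute value into
  \<open>[0, pi]\<close>, where cos is decreasing.\<close>

lemma cos_between_iff:
  assumes "0 < a" "0 \<le> d" "a + d \<le> pi"
  shows "cos (a + d) \<le> cos x \<and> cos x \<le> cos d \<longleftrightarrow>
    (\<exists>m::int. d \<le> \<bar>x - 2 * pi * of_int m\<bar> \<and> \<bar>x - 2 * pi * of_int m\<bar> \<le> a + d)"
proof -
  have cosm: "cos \<bar>x - 2 * pi * of_int m\<bar> = cos x" for m :: int
    using cos_int_2pin[of m] sin_int_2pin[of m] by (simp add: cos_abs_real cos_diff)
  have mono: "cos (a + d) \<le> cos y \<and> cos y \<le> cos d \<longleftrightarrow> d \<le> y \<and> y \<le> a + d" if "0 \<le> y" "y \<le> pi" for y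
    using assms that cos_mono_le_eq[of "a + d" y] cos_mono_le_eq[of y d] by auto
  show ?thesis
  proof
    assume *: "cos (a + d) \<le> cos x \<and> cos x \<le> cos d"
    define m where "m = round (x / (2 * pi))"
    have "\<bar>of_int m - x / (2 * pi)\<bar> \<le> 1 / 2" unfolding m_def by (rule of_int_round_abs_le)
    then have "\<bar>x - 2 * pi * of_int m\<bar> \<le> pi" by (simp add: abs_le_iff field_simps)
    then show "\<exists>m::int. d \<le> \<bar>x - 2 * pi * of_int m\<bar> \<and> \<bar>x - 2 * pi * of_int m\<bar> \<le> a + d"
      using mono[of "\<bar>x - 2 * pi * of_int m\<bar>"] * cosm by auto
  next
    assume "\<exists>m::int. d \<le> \<bar>x - 2 * pi * of_int m\<bar> \<and> \<bar>x - 2 * pi * of_int m\<bar> \<le> a + d"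
    then obtain m :: int where m: "d \<le> \<bar>x - 2 * pi * of_int m\<bar>" "\<bar>x - 2 * pi * of_int m\<bar> \<le> a + d" by blast
    then show "cos (a + d) \<le> cos x \<and> cos x \<le> cos d"
      using mono[of "\<bar>x - 2 * pi * of_int m\<bar>"] cosm[of m] assms by auto
  qed
qed

text \<open>In the variable \<open>k * l - t\<close> the set is the preimage under cos of
  \<open>[cos (a + d), cos d]\<close>. \<open>M\<close> and \<open>r\<close> are the midpoint and
  half-length of this interval, and the product formula for sines rewrites \<open>r\<close>.\<close>

lemma root_sigma_tendsto_arcs:
  fixes f :: "real \<Rightarrow> real"
  assumes sd: "spectral_density f"
    and pos: "AE l in lebesgue. l \<in> {l\<in>{-pi..pi}. cis l \<in> closure (Ef f)} \<longrightarrow> 0 < f l"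
    and k: "0 < k" and a: "0 < a" and d: "0 \<le> d" and ad: "a + d \<le> pi"
    and K: "\<And>l. cis l \<in> closure (Ef f) \<longleftrightarrow>
      (\<exists>m::int. d \<le> \<bar>real k * l - t - 2 * pi * of_int m\<bar> \<and> \<bar>real k * l - t - 2 * pi * of_int m\<bar> \<le> a + d)"
  shows "(\<lambda>n. root n (sigma f n)) \<longlonglongrightarrow> (sin (a / 2) * sin (a / 2 + d)) powr (1 / (2 * real k))"
proof -
  define M r where "M = (cos d + cos (a + d)) / 2" and "r = (cos d - cos (a + d)) / 2"
  have r_eq: "r = sin (a / 2) * sin (a / 2 + d)"
  proof -
    have "sin (a / 2 + d) * sin (a / 2) = (cos ((a / 2 + d) - a / 2) - cos ((a / 2 + d) + a / 2)) / 2"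
      by (rule sin_times_sin)
    also have "\<dots> = r" by (simp add: r_def algebra_simps)
    finally show ?thesis by (simp add: mult.commute)
  qed
  have r: "0 < r" using a d ad cos_monotone_0_pi[of d "a + d"] by (simp add: r_def)
  have M: "\<bar>M\<bar> + r \<le> 1"
  proof -
    have "M + r = cos d" "M - r = cos (a + d)" by (simp_all add: M_def r_def field_simps)
    then show ?thesis using cos_le_one[of d] cos_ge_minus_one[of "a + d"] by linarith
  qed
  have iff: "cis l \<in> closure (Ef f) \<longleftrightarrow> \<bar>cos (real k * l - t) - M\<bar> \<le> r" for l
    unfolding K cos_between_iff[OF a d ad, symmetric] by (auto simp: M_def r_def abs_le_iff field_simps)
  have "(\<lambda>n. root n (sigma f n)) \<longlonglongrightarrow> r powr (1 / (2 * real k))"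
  proof (rule root_sigma_tendsto[OF sd r M k])
    fix l assume "l \<in> {-pi..pi}" "0 < f l"
    then have "cis l \<in> Ef f" by (auto simp: Ef_def)
    then show "\<bar>cos (real k * l - t) - M\<bar> \<le> r" using iff closure_subset by blast
  next
    show "AE l in lebesgue. l \<in> {-pi..pi} \<longrightarrow> \<bar>cos (real k * l - t) - M\<bar> < r \<longrightarrow> 0 < f l"
      using pos by eventually_elim (use iff in auto)
  qed
  then show ?thesis by (simp add: r_eq)
qed

section \<open>Membership in the arc families in terms of the argument\<close>

lemma cis_eq_cis_iff: "cis x = cis y \<longleftrightarrow> (\<exists>m::int. x = y + 2 * pi * of_int m)"
  using sin_cos_eq_iff[of x y] by (auto simp: complex_eq_iff mult_ac)

lemma cis_in_arcs_ad_iff: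
  "cis l \<in> arcs_ad a d t \<longleftrightarrow>
    (\<exists>m::int. d \<le> \<bar>l - t - 2 * pi * of_int m\<bar> \<and> \<bar>l - t - 2 * pi * of_int m\<bar> \<le> a + d)"
proof -
  have "cis l \<in> arcs_ad a d t \<longleftrightarrow> (\<exists>s. cis l = cis s \<and> d \<le> \<bar>s - t\<bar> \<and> \<bar>s - t\<bar> \<le> a + d)"
    by (auto simp: arcs_ad_def add.commute)
  also have "\<dots> \<longleftrightarrow> (\<exists>m::int. d \<le> \<bar>l - 2 * pi * of_int m - t\<bar> \<and> \<bar>l - 2 * pi * of_int m - t\<bar> \<le> a + d)"
    unfolding cis_eq_cis_iff by (metis add_diff_cancel diff_add_cancel)
  finally show ?thesis by (simp add: algebra_simps)
qed

text \<open>With gap 0 the two arcs meet at the centre.\<close>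

lemma arc2_eq_arcs_ad: "arc2 a t = arcs_ad a 0 t"
  by (simp add: arc2_def arcs_ad_def)

text \<open>Multiplying the argument by \<open>k\<close> stacks the arcs on one another. An integer
  \<open>j + k * m\<close> with \<open>j < k\<close> encodes both the arc \<open>j\<close> and the
  winding \<open>m\<close> of the argument.\<close>

lemma cis_in_arcs_k_iff:
  assumes "0 < k"
  shows "cis l \<in> arcs_k k a t \<longleftrightarrow>
    (\<exists>m::int. \<bar>real k * l - real k * t - 2 * pi * of_int m\<bar> \<le> real k * a / 2)"
proof -
  have eq: "\<bar>real k * l - real k * t - 2 * pi * of_int (int j + int k * m)\<bar>
      = real k * \<bar>l - (t + 2 * pi * real j / real k) - 2 * pi * of_int m\<bar>" for j m
  proof -
    have "real k * l - real k * t - 2 * pi * of_int (int j + int k * m)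
      = real k * (l - (t + 2 * pi * real j / real k) - 2 * pi * of_int m)"
      using assms by (simp add: field_simps)
    then show ?thesis by (simp only: abs_mult abs_of_nat)
  qed
  have le: "real k * x \<le> real k * a / 2 \<longleftrightarrow> x \<le> a / 2" for x
    using assms by (simp add: field_simps)
  have "cis l \<in> arcs_k k a t \<longleftrightarrow>
      (\<exists>j<k. \<exists>m::int. \<bar>real k * l - real k * t - 2 * pi * of_int (int j + int k * m)\<bar> \<le> real k * a / 2)"
    unfolding eq le arcs_k_def arc2_eq_arcs_ad by (auto simp: cis_in_arcs_ad_iff)
  also have "\<dots> \<longleftrightarrow> (\<exists>m::int. \<bar>real k * l - real k * t - 2 * pi * of_int m\<bar> \<le> real k * a / 2)"
  proof
    assume "\<exists>m::int. \<bar>real k * l - real k * t - 2 * pi * of_int m\<bar> \<le> real k * a / 2"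
    then obtain m :: int where m: "\<bar>real k * l - real k * t - 2 * pi * of_int m\<bar> \<le> real k * a / 2" by blast
    have "nat (m mod int k) < k" "int (nat (m mod int k)) + int k * (m div int k) = m"
      using assms by (simp_all add: nat_less_iff)
    then show "\<exists>j<k. \<exists>m::int. \<bar>real k * l - real k * t - 2 * pi * of_int (int j + int k * m)\<bar> \<le> real k * a / 2"
      using m by metis
  qed blast
  finally show ?thesis .
qed

text \<open>The second pair of arcs is the first pair turned by pi, so the set is invariant under
  that rotation; doubling the argument leaves one pair with both parameters doubled.\<close>

lemma cis_in_Delta_ad_iff:
  assumes d: "0 \<le> d"
  shows "cis l \<in> Delta_ad a d t \<longleftrightarrow>
    (\<exists>m::int. 2 * d \<le> \<bar>2 * l - 2 * t - 2 * pi * of_int m\<bar> \<and> \<bar>2 * l - 2 * t - 2 * pi * of_int m\<bar> \<le> 2 * a + 2 * d)"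
proof -
  define x where "x = l - t"
  have "arcs_ad' a d = arcs_ad a d pi"
  proof -
    have "cis s \<in> arcs_ad' a d" if "d \<le> \<bar>s - pi\<bar>" "\<bar>s - pi\<bar> \<le> d + a" for s
    proof (cases "s \<le> pi")
      case True
      then show ?thesis using that by (auto simp: arcs_ad'_def)
    next
      case False
      then have "s - 2 * pi \<in> {-pi + d .. -pi + d + a}" using that by auto
      moreover have "cis s = cis (s - 2 * pi)" by (simp add: complex_eq_iff sin_diff cos_diff)
      ultimately show ?thesis unfolding arcs_ad'_def by blast
    qed
    moreover have "cis s \<in> arcs_ad a d pi" if "s \<in> {-pi + d .. -pi + d + a}" "0 \<le> d" for s
    proof -
      have "d \<le> \<bar>(s + 2 * pi) - pi\<bar>" "\<bar>(s + 2 * pi) - pi\<bar> \<le> d + a" using that by auto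
      moreover have "cis s = cis (s + 2 * pi)" by (simp add: complex_eq_iff)
      ultimately show ?thesis unfolding arcs_ad_def by blast
    qed
    moreover have "cis s \<in> arcs_ad a d pi" if "s \<in> {pi - d - a .. pi - d}" "0 \<le> d" for s
    proof -
      have "d \<le> \<bar>s - pi\<bar>" "\<bar>s - pi\<bar> \<le> d + a" using that by auto
      then show ?thesis unfolding arcs_ad_def by blast
    qed
    ultimately show ?thesis using d unfolding arcs_ad'_def[of a d] arcs_ad_def[of a d pi] by blast
  qed
  moreover have "cis l \<in> Delta_ad a d t \<longleftrightarrow> cis x \<in> arcs_ad a d 0 \<union> arcs_ad' a d"
  proof -
    have "cis l = cis t * cis x" by (simp add: x_def cis_mult)
    then show ?thesis by (auto simp: Delta_ad_def)
  qed
  ultimately have "cis l \<in> Delta_ad a d t \<longleftrightarrow>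
      (\<exists>m::int. d \<le> \<bar>x - 2 * pi * of_int m\<bar> \<and> \<bar>x - 2 * pi * of_int m\<bar> \<le> a + d) \<or>
      (\<exists>m::int. d \<le> \<bar>x - pi - 2 * pi * of_int m\<bar> \<and> \<bar>x - pi - 2 * pi * of_int m\<bar> \<le> a + d)"
    by (simp add: cis_in_arcs_ad_iff)
  \<comment> \<open>Even multiples of pi belong to the pair around 0, odd ones to the pair around
    pi.\<close>
  also have "\<dots> \<longleftrightarrow> (\<exists>m::int. d \<le> \<bar>x - pi * of_int m\<bar> \<and> \<bar>x - pi * of_int m\<bar> \<le> a + d)" (is "?A \<or> ?B \<longleftrightarrow> ?C")
  proof
    assume "?A \<or> ?B"
    then show ?C
    proof
      assume ?A
      then obtain m :: int where "d \<le> \<bar>x - 2 * pi * of_int m\<bar> \<and> \<bar>x - 2 * pi * of_int m\<bar> \<le> a + d" by blast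
      then show ?C by (intro exI[of _ "2 * m"]) (simp add: mult_ac)
    next
      assume ?B
      then obtain m :: int where "d \<le> \<bar>x - pi - 2 * pi * of_int m\<bar> \<and> \<bar>x - pi - 2 * pi * of_int m\<bar> \<le> a + d" by blast
      then show ?C by (intro exI[of _ "2 * m + 1"]) (simp add: algebra_simps)
    qed
  next
    assume ?C
    then obtain m :: int where m: "d \<le> \<bar>x - pi * of_int m\<bar> \<and> \<bar>x - pi * of_int m\<bar> \<le> a + d" by blast
    show "?A \<or> ?B"
    proof (cases "even m")
      case True
      then obtain j where "m = 2 * j" by blast
      then show ?thesis using m by (intro disjI1 exI[of _ j]) (simp add: mult_ac)
    next
      case False
      then obtain j where "m = 2 * j + 1" using oddE by blast
      then show ?thesis using m by (intro disjI2 exI[of _ j]) (simp add: algebra_simps)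
    qed
  qed
  also have "\<dots> \<longleftrightarrow> (\<exists>m::int. 2 * d \<le> \<bar>2 * l - 2 * t - 2 * pi * of_int m\<bar> \<and>
      \<bar>2 * l - 2 * t - 2 * pi * of_int m\<bar> \<le> 2 * a + 2 * d)"
  proof -
    have "\<bar>2 * l - 2 * t - 2 * pi * of_int m\<bar> = 2 * \<bar>x - pi * of_int m\<bar>" for m :: int
      by (simp add: x_def abs_if)
    then show ?thesis by auto
  qed
  finally show ?thesis .
qed

theorem mainTheorem6:
  fixes f :: "real \<Rightarrow> real"
  assumes sd: "spectral_density f"
    and pos: "AE l in lebesgue. l \<in> {l\<in>{-pi..pi}. cis l \<in> closure (Ef f)} \<longrightarrow> 0 < f l"
  shows "(\<forall>\<alpha> \<theta>0. 0 < \<alpha> \<and> \<alpha> < pi \<and> -pi \<le> \<theta>0 \<and> \<theta>0 < pi \<and> closure (Ef f) = arc2 \<alpha> \<theta>0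
            \<longrightarrow> (\<lambda>n. root n (sigma f n)) \<longlonglongrightarrow> sin (\<alpha> / 2)) \<and>
    (\<forall>(k::nat) \<alpha> \<theta>0. 2 \<le> k \<and> 0 < \<alpha> \<and> real k * \<alpha> < 2 * pi \<and> closure (Ef f) = arcs_k k \<alpha> \<theta>0
            \<longrightarrow> (\<lambda>n. root n (sigma f n)) \<longlonglongrightarrow> sin (real k * \<alpha> / 4) powr (1 / real k)) \<and>
    (\<forall>\<alpha> \<delta> \<theta>0. 0 < \<alpha> \<and> 0 \<le> \<delta> \<and> \<alpha> + \<delta> \<le> pi \<and> -pi \<le> \<theta>0 \<and> \<theta>0 < pi
              \<and> closure (Ef f) = arcs_ad \<alpha> \<delta> \<theta>0
            \<longrightarrow> (\<lambda>n. root n (sigma f n)) \<longlonglongrightarrow> (sin (\<alpha> / 2) * sin (\<alpha> / 2 + \<delta>)) powr (1 / 2)) \<and>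
    (\<forall>\<alpha> \<delta> \<theta>0. 0 < \<alpha> \<and> 0 \<le> \<delta> \<and> \<alpha> + \<delta> \<le> pi / 2 \<and> -pi \<le> \<theta>0 \<and> \<theta>0 < pi
              \<and> closure (Ef f) = Delta_ad \<alpha> \<delta> \<theta>0
            \<longrightarrow> (\<lambda>n. root n (sigma f n)) \<longlonglongrightarrow> (sin \<alpha> * sin (\<alpha> + 2 * \<delta>)) powr (1 / 4))"
proof (intro conjI allI impI; elim conjE)
  fix \<alpha> \<theta>0 :: real
  assume \<alpha>: "0 < \<alpha>" "\<alpha> < pi" and K: "closure (Ef f) = arc2 \<alpha> \<theta>0"
  \<comment> \<open>Gap 0 and \<open>k = 1\<close>: the product is a square and the exponent 1/2
    undoes it.\<close>
  have "(\<lambda>n. root n (sigma f n)) \<longlonglongrightarrow> (sin (\<alpha> / 2) * sin (\<alpha> / 2 + 0)) powr (1 / (2 * real 1))"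
    by (rule root_sigma_tendsto_arcs[where t = \<theta>0, OF sd pos])
       (use \<alpha> in \<open>simp_all add: K arc2_eq_arcs_ad cis_in_arcs_ad_iff\<close>)
  moreover have "0 < sin (\<alpha> / 2)" using \<alpha> by (intro sin_gt_zero) auto
  ultimately show "(\<lambda>n. root n (sigma f n)) \<longlonglongrightarrow> sin (\<alpha> / 2)"
    by (simp add: powr_half_sqrt)
next
  fix k :: nat and \<alpha> \<theta>0 :: real
  assume k: "2 \<le> k" and \<alpha>: "0 < \<alpha>" "real k * \<alpha> < 2 * pi" and K: "closure (Ef f) = arcs_k k \<alpha> \<theta>0"
  define s where "s = sin (real k * \<alpha> / 4)"
  \<comment> \<open>Each arc has half-length \<open>\<alpha> / 2\<close>, which becomes
    \<open>k * \<alpha> / 2\<close> in the variable \<open>k * l\<close>; the gap is again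
    0.\<close>
  have "(\<lambda>n. root n (sigma f n)) \<longlonglongrightarrow>
      (sin (real k * \<alpha> / 2 / 2) * sin (real k * \<alpha> / 2 / 2 + 0)) powr (1 / (2 * real k))"
    by (rule root_sigma_tendsto_arcs[where t = "real k * \<theta>0", OF sd pos])
       (use k \<alpha> in \<open>simp_all add: K cis_in_arcs_k_iff\<close>)
  then have "(\<lambda>n. root n (sigma f n)) \<longlonglongrightarrow> (s * s) powr (1 / (2 * real k))"
    by (simp add: s_def)
  moreover have "0 < real k * \<alpha>" using k \<alpha> by simp
  then have "0 < s" unfolding s_def by (intro sin_gt_zero) (use \<alpha> pi_gt_zero in linarith)+
  then have "(s * s) powr (1 / (2 * real k)) = s powr (1 / real k)"
    by (simp add: powr_mult powr_add[symmetric])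
  ultimately show "(\<lambda>n. root n (sigma f n)) \<longlonglongrightarrow> sin (real k * \<alpha> / 4) powr (1 / real k)"
    by (simp add: s_def)
next
  fix \<alpha> \<delta> \<theta>0 :: real
  assume "0 < \<alpha>" "0 \<le> \<delta>" "\<alpha> + \<delta> \<le> pi" and K: "closure (Ef f) = arcs_ad \<alpha> \<delta> \<theta>0"
  then have "(\<lambda>n. root n (sigma f n)) \<longlonglongrightarrow> (sin (\<alpha> / 2) * sin (\<alpha> / 2 + \<delta>)) powr (1 / (2 * real 1))"
    by (intro root_sigma_tendsto_arcs[where t = \<theta>0, OF sd pos]) (simp_all add: K cis_in_arcs_ad_iff)
  then show "(\<lambda>n. root n (sigma f n)) \<longlonglongrightarrow> (sin (\<alpha> / 2) * sin (\<alpha> / 2 + \<delta>)) powr (1 / 2)"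
    by simp
next
  fix \<alpha> \<delta> \<theta>0 :: real
  assume \<alpha>: "0 < \<alpha>" "0 \<le> \<delta>" "\<alpha> + \<delta> \<le> pi / 2" and K: "closure (Ef f) = Delta_ad \<alpha> \<delta> \<theta>0"
  \<comment> \<open>Here \<open>k = 2\<close> with doubled parameters, and
    \<open>\<alpha> + \<delta> <= pi / 2\<close> becomes the required bound pi.\<close>
  have "(\<lambda>n. root n (sigma f n)) \<longlonglongrightarrow>
      (sin (2 * \<alpha> / 2) * sin (2 * \<alpha> / 2 + 2 * \<delta>)) powr (1 / (2 * real 2))"
    by (rule root_sigma_tendsto_arcs[where t = "2 * \<theta>0", OF sd pos])
       (use \<alpha> in \<open>simp_all add: K cis_in_Delta_ad_iff\<close>)
  then show "(\<lambda>n. root n (sigma f n)) \<longlonglongrightarrow> (sin \<alpha> * sin (\<alpha> + 2 * \<delta>)) powr (1 / 4)"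
    by simp
qed

end
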